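(* Let $\mathbb{K}$ be a field of characteristic zero and let $N\ge 1$. Let $d$ and $m$ be positive integers with $d\geq m$. Let $P_1,\dots,P_s$ be pairwise distinct points in $\mathbb{P}^N=\mathbb{P}^N(\mathbb{K})$, where $s$ is such that $$\binom{d+N}{N}=\binom{m+N-1}{N}+s,$$ and put $Z=\{P_1,\dots,P_s\}$. Let $B$ be a fixed point in $\mathbb{P}^N$, and let $F(a_0,\dots,a_N)=\det M$ be the determinant of the interpolation matrix $M$ of $Z$ for degree $d$ and multiplicity $m$ (as defined in the context), a polynomial of degree $\binom{m+N-1}{N}(d-m+1)$ (possibly identically zero). Define $$h_{j,B}:=\begin{cases}\dim\mathcal{L}(d;jB+Z)-\left(\binom{d+N}{N}-\binom{j+N-1}{N}-s\right), & j=1,\dots,m,\\[4pt] \dim\mathcal{L}(d;jB+Z), & j=m+1,\dots,d,\end{cases}$$ and $h_B:=\sum_{j=1}^d h_{j,B}$. Then the multiplicity of $B$ in the set $F=0$ is at least $h_B$.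
   Context: Linear systems: for a point $B\in\mathbb{P}^N$, a finite set $Z\subset\mathbb{P}^N$ and an integer $j\ge 1$, $\mathcal{L}(d;jB+Z)$ denotes the $\mathbb{K}$-vector space of homogeneous forms of degree $d$ in $N+1$ variables (including $0$) that vanish at every point of $Z$ and vanish to order at least $j$ at $B$; $\dim$ is the vector space dimension. The point $B$ is allowed to lie in $Z$. Interpolation matrix: let $w(a_0,\dots,a_N)=(a_0^d,a_0^{d-1}a_1,\dots,a_{N-1}a_N^{d-1},a_N^d)$ be the vector of all $\binom{d+N}{N}$ monomials of degree $d$ in $a_0,\dots,a_N$ in a fixed order. Fix coordinates $(p_{i0},\dots,p_{iN})$ of each $P_i$. $M$ is the square matrix of size $\binom{d+N}{N}$ whose first $s$ rows are $w(P_1),\dots,w(P_s)$ (constants), and whose remaining $\binom{m+N-1}{N}$ rows are all the partial derivatives of $w$ of order exactly $m-1$, i.e. $\frac{\partial^{m-1} w}{\partial a_0^{i_0}\cdots\partial a_N^{i_N}}$ with $i_0+\cdots+i_N=m-1$, in a fixed order. Thus $F=\det M\in\mathbb{K}[a_0,\dots,a_N]$ is homogeneous, and is well defined up to a nonzero scalar (depending on orderings and coordinates chosen for the $P_i$). The multiplicity of $B$ in the set $F=0$ is the order of vanishing of $F$ at $B$ (that is, the largest $k$ such that all partial derivatives of $F$ of order less than $k$ vanish at $B$), with the convention that it is $+\infty$ if $F\equiv 0$. *)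

theory Defs
  imports
    "HOL-Library.Poly_Mapping"
    "HOL-Library.Extended_Real"
    "Jordan_Normal_Form.Determinant"
begin

(* Multivariate polynomials in variables a_0, a_1, ... as finitely supported maps from exponent
   vectors to coefficients; the ring structure is the one of Poly_Mapping. *)
type_synonym 'k mpoly = "(nat \<Rightarrow>\<^sub>0 nat) \<Rightarrow>\<^sub>0 'k"

definition mpoly_smult :: "'k::field \<Rightarrow> 'k mpoly \<Rightarrow> 'k mpoly" where
  "mpoly_smult c f = Poly_Mapping.map ((*) c) f"

lemma lookup_mpoly_smult [simp]: "poly_mapping.lookup (mpoly_smult c f) t = c * poly_mapping.lookup f t"
  by (simp add: mpoly_smult_def Poly_Mapping.map.rep_eq when_def)

interpretation mpoly: vector_space "mpoly_smult :: 'k::field \<Rightarrow> 'k mpoly \<Rightarrow> 'k mpoly"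
  by unfold_locales (auto intro!: poly_mapping_eqI simp: lookup_add algebra_simps)

definition mpoly_const :: "'k::zero \<Rightarrow> 'k mpoly" where
  "mpoly_const c = Poly_Mapping.single 0 c"

definition mpoly_eval :: "'k::comm_ring_1 vec \<Rightarrow> 'k mpoly \<Rightarrow> 'k" where
  "mpoly_eval v f = (\<Sum>t\<in>Poly_Mapping.keys f. poly_mapping.lookup f t * (\<Prod>i\<in>Poly_Mapping.keys t. v $ i ^ poly_mapping.lookup t i))"

definition mpoly_pderiv :: "nat \<Rightarrow> 'k::comm_ring_1 mpoly \<Rightarrow> 'k mpoly" where
  "mpoly_pderiv i f =
     (\<Sum>t\<in>Poly_Mapping.keys f. Poly_Mapping.single (t - Poly_Mapping.single i 1) (of_nat (poly_mapping.lookup t i) * poly_mapping.lookup f t))"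

(* The exponent vectors (e_0, ..., e_N) with e_0 + ... + e_N = k. *)
definition exponents :: "nat \<Rightarrow> nat \<Rightarrow> (nat \<Rightarrow>\<^sub>0 nat) set" where
  "exponents N k = {e. Poly_Mapping.keys e \<subseteq> {..N} \<and> (\<Sum>i\<le>N. poly_mapping.lookup e i) = k}"

(* For e in exponents N k, the k-th order derivative with respect to a_i taken e_i times
   for each i = 0, ..., N. *)
definition mpoly_partial :: "nat \<Rightarrow> (nat \<Rightarrow>\<^sub>0 nat) \<Rightarrow> 'k::comm_ring_1 mpoly \<Rightarrow> 'k mpoly" where
  "mpoly_partial N e = fold (\<lambda>i g. (mpoly_pderiv i ^^ poly_mapping.lookup e i) g) [0..<Suc N]"

definition forms :: "nat \<Rightarrow> nat \<Rightarrow> 'k::zero mpoly set" where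
  "forms N d = {f. Poly_Mapping.keys f \<subseteq> exponents N d}"

definition proj_rel :: "nat \<Rightarrow> ('k::field vec \<times> 'k vec) set" where
  "proj_rel N = {(u, v). u \<in> carrier_vec (Suc N) - {0\<^sub>v (Suc N)} \<and>
                         v \<in> carrier_vec (Suc N) - {0\<^sub>v (Suc N)} \<and>
                         (\<exists>c. c \<noteq> 0 \<and> v = c \<cdot>\<^sub>v u)}"

(* A point is the set of all its homogeneous coordinate vectors. *)
definition proj_space :: "nat \<Rightarrow> 'k::field vec set set" where
  "proj_space N = (carrier_vec (Suc N) - {0\<^sub>v (Suc N)}) // proj_rel N"

definition vanishes_at :: "'k::field mpoly \<Rightarrow> 'k vec set \<Rightarrow> bool" where
  "vanishes_at f P \<longleftrightarrow> (\<forall>v\<in>P. mpoly_eval v f = 0)"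

definition vanishes_to_order :: "nat \<Rightarrow> nat \<Rightarrow> 'k::field mpoly \<Rightarrow> 'k vec set \<Rightarrow> bool" where
  "vanishes_to_order N j f P \<longleftrightarrow>
     (\<forall>r<j. \<forall>e\<in>exponents N r. vanishes_at (mpoly_partial N e f) P)"

definition vanishing_order :: "nat \<Rightarrow> 'k::field mpoly \<Rightarrow> 'k vec set \<Rightarrow> enat" where
  "vanishing_order N f P = (if f = 0 then \<infinity> else enat (GREATEST k. vanishes_to_order N k f P))"

definition linsys :: "nat \<Rightarrow> nat \<Rightarrow> nat \<Rightarrow> 'k::field vec set \<Rightarrow> 'k vec set set \<Rightarrow> 'k mpoly set" where
  "linsys N d j B Z =
     {f \<in> forms N d. (\<forall>P\<in>Z. vanishes_at f P) \<and> vanishes_to_order N j f B}"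

(* mons lists the exponents of the monomials of w, and ders lists the derivatives used for the
   rows below the first s; p i is the chosen coordinate vector of the (i+1)-st point. *)
definition interp_matrix ::
  "nat \<Rightarrow> nat \<Rightarrow> nat \<Rightarrow> (nat \<Rightarrow> 'k::field vec) \<Rightarrow> (nat \<Rightarrow>\<^sub>0 nat) list \<Rightarrow> (nat \<Rightarrow>\<^sub>0 nat) list
    \<Rightarrow> 'k mpoly mat" where
  "interp_matrix N d s p mons ders =
     mat ((d + N) choose N) ((d + N) choose N) (\<lambda>(i, l).
       let w = Poly_Mapping.single (mons ! l) 1 in
       if i < s then mpoly_const (mpoly_eval (p i) w)
       else mpoly_partial N (ders ! (i - s)) w)"

definition h_at ::
  "nat \<Rightarrow> nat \<Rightarrow> nat \<Rightarrow> nat \<Rightarrow> 'k::field vec set set \<Rightarrow> 'k vec set \<Rightarrow> nat \<Rightarrow> int" where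
  "h_at N d m s Z B j =
     (if j \<le> m
      then int (mpoly.dim (linsys N d j B Z))
           - (int ((d + N) choose N) - int ((j + N - 1) choose N) - int s)
      else int (mpoly.dim (linsys N d j B Z)))"

definition h_total ::
  "nat \<Rightarrow> nat \<Rightarrow> nat \<Rightarrow> nat \<Rightarrow> 'k::field vec set set \<Rightarrow> 'k vec set \<Rightarrow> int" where
  "h_total N d m s Z B = (\<Sum>j = 1..d. h_at N d m s Z B j)"

end

theory Submission
  imports Defs
begin

text \<open>
  Fix a representative \<open>b\<close> of \<open>B\<close> and an index \<open>i0\<close> with \<open>b $ i0 \<noteq> 0\<close>. The polynomials that vanish
  at \<open>b\<close> to order at least \<open>k\<close> form a filtration that is compatible with products, so a determinant
  whose entry in row \<open>i\<close> and column \<open>l\<close> has order at least \<open>\<omega> l - w i\<close> has order at least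
  \<open>\<Sum>l. \<omega> l - \<Sum>i. w i\<close>: in the Leibniz expansion every permutation collects all the \<open>\<omega> l\<close> and all
  the \<open>w i\<close> (\<open>vanish_ge_det\<close>). The proof writes the interpolation matrix as \<open>U * A * Q\<close> with
  constant matrices \<open>U\<close> and \<open>Q\<close>, where \<open>A\<close> has such entries and
  \<open>\<Sum>l. \<omega> l - \<Sum>i. w i\<close> is exactly \<open>h_total\<close>.

  The matrix \<open>Q\<close> changes the basis of the forms of degree \<open>d\<close>. The monomials are replaced by a basis
  \<open>f 0, f 1, \<dots>\<close> that is compatible with the descending chain of the systems \<open>L(d; jB + Z)\<close>
  (\<open>adapted_basis\<close>). Let \<open>\<omega> l\<close> be the largest \<open>j\<close> for which \<open>f l\<close> was chosen in the \<open>j\<close>-th system;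
  then \<open>\<Sum>l. \<omega> l\<close> is the sum of the dimensions for \<open>j = 1, \<dots>, d\<close>. In the first \<open>s\<close> rows, the
  columns with \<open>\<omega> l > 0\<close> are zero, because those \<open>f l\<close> vanish on \<open>Z\<close>; hence \<open>w i = 0\<close> is admissible
  there.

  The matrix \<open>U\<close> changes the derivatives. A derivative of order \<open>m - 1\<close> lowers the order of vanishing
  by up to \<open>m - 1\<close>, which is too much. But the derivative in the radial direction \<open>b\<close> does not lower
  the order of vanishing of a form at \<open>b\<close> at all, by Euler's formula (\<open>vanish_ge_dir_deriv\<close>). As
  \<open>b $ i0 \<noteq> 0\<close>, the derivative in the direction \<open>b\<close> may be used in place of the one with respect to
  the variable \<open>i0\<close> (\<open>mpoly_partial_eq_adapted\<close>), and then the row of the exponent vector \<open>e\<close> only has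
  weight \<open>m - 1\<close> minus the exponent of \<open>i0\<close> (\<open>vanish_ge_adapted_partial\<close>). Counting exponent
  vectors, these weights sum up to the correction terms \<open>C(d+N,N) - C(j+N-1,N) - s\<close> in \<open>h_total\<close>
  (\<open>sum_adapted_weights\<close>).

  Finally, \<open>vanishing_order\<close> is a greatest element, so the lower bound is only meaningful because a
  nonzero polynomial in the variables \<open>0, \<dots>, N\<close> over a field of characteristic zero has finite order at every point
  (\<open>finite_vanishing_order\<close>).
\<close>

section \<open>Formal derivatives and evaluation\<close>

lemma lookup_mpoly_pderiv:
  "poly_mapping.lookup (mpoly_pderiv i f) t
     = of_nat (poly_mapping.lookup t i + 1) * poly_mapping.lookup f (t + Poly_Mapping.single i 1)"
proof -
  let ?t = "t + Poly_Mapping.single i (1::nat)"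
  have eq: "(of_nat (poly_mapping.lookup u i) * poly_mapping.lookup f u
               when u - Poly_Mapping.single i 1 = t)
          = (of_nat (poly_mapping.lookup u i) * poly_mapping.lookup f u when u = ?t)" for u
  proof (cases "poly_mapping.lookup u i = 0")
    case False
    then have "u = (u - Poly_Mapping.single i 1) + Poly_Mapping.single i 1"
      by (intro poly_mapping_eqI) (auto simp: lookup_add lookup_minus lookup_single when_def)
    then have "u - Poly_Mapping.single i 1 = t \<longleftrightarrow> u = ?t"
      by (metis add_diff_cancel_right')
    then show ?thesis by simp
  qed (auto simp: when_def lookup_add)
  have "poly_mapping.lookup (mpoly_pderiv i f) t
      = (\<Sum>u\<in>Poly_Mapping.keys f. of_nat (poly_mapping.lookup u i) * poly_mapping.lookup f u when u = ?t)"
    unfolding mpoly_pderiv_def lookup_sum lookup_single by (simp only: eq)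
  also have "\<dots> = of_nat (poly_mapping.lookup ?t i) * poly_mapping.lookup f ?t"
    by (auto simp: when_def in_keys_iff)
  finally show ?thesis by (simp add: lookup_add)
qed

lemma mpoly_pderiv_0 [simp]: "mpoly_pderiv i 0 = 0"
  by (simp add: mpoly_pderiv_def)

lemma mpoly_pderiv_add: "mpoly_pderiv i (f + g) = mpoly_pderiv i f + mpoly_pderiv i g"
  by (intro poly_mapping_eqI) (simp add: lookup_mpoly_pderiv lookup_add algebra_simps)

lemma mpoly_pderiv_smult: "mpoly_pderiv i (mpoly_smult c f) = mpoly_smult c (mpoly_pderiv i f)"
  by (intro poly_mapping_eqI) (simp add: lookup_mpoly_pderiv algebra_simps)

lemma mpoly_pderiv_commute:
  "mpoly_pderiv i (mpoly_pderiv j f) = mpoly_pderiv j (mpoly_pderiv i f)"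
  by (intro poly_mapping_eqI)
    (auto simp: lookup_mpoly_pderiv lookup_add lookup_single when_def algebra_simps)

lemma mpoly_pderiv_single:
  "mpoly_pderiv i (Poly_Mapping.single t c)
     = Poly_Mapping.single (t - Poly_Mapping.single i 1) (of_nat (poly_mapping.lookup t i) * c)"
  by (cases "c = 0") (simp_all add: mpoly_pderiv_def)

lemma mpoly_eq_sum_single:
  fixes f :: "'k::comm_monoid_add mpoly"
  shows "f = (\<Sum>t\<in>Poly_Mapping.keys f. Poly_Mapping.single t (poly_mapping.lookup f t))"
  by (intro poly_mapping_eqI) (auto simp: lookup_sum lookup_single when_def in_keys_iff)

text \<open>
  Reduces an identity that is additive in a polynomial to single terms; products are then handled by
  using the rule once for each factor.
\<close>

lemma mpoly_additive_induct [case_names zero single add]: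
  fixes f :: "'k::comm_monoid_add mpoly"
  assumes "Q 0" "\<And>t c. Q (Poly_Mapping.single t c)" "\<And>f g. Q f \<Longrightarrow> Q g \<Longrightarrow> Q (f + g)"
  shows "Q f"
proof -
  have "Q (\<Sum>t\<in>X. Poly_Mapping.single t (poly_mapping.lookup f t))" if "finite X" for X
    using that by (induction X rule: finite_induct) (auto intro: assms)
  then show ?thesis
    using mpoly_eq_sum_single[of f] by (metis finite_keys)
qed

lemma single_diff_add_single:
  fixes t u :: "nat \<Rightarrow>\<^sub>0 nat"
  assumes "poly_mapping.lookup t i \<noteq> 0"
  shows "t - Poly_Mapping.single i 1 + u = t + u - Poly_Mapping.single i 1"
  using assms
  by (intro poly_mapping_eqI) (auto simp: lookup_add lookup_minus lookup_single when_def)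

lemma mpoly_pderiv_mult:
  "mpoly_pderiv i (f * g) = mpoly_pderiv i f * g + f * mpoly_pderiv i g"
proof (induction f rule: mpoly_additive_induct)
  case (single t c)
  show ?case
  proof (induction g rule: mpoly_additive_induct)
    case (single u d)
    have 1: "mpoly_pderiv i (Poly_Mapping.single t c) * Poly_Mapping.single u d
        = Poly_Mapping.single (t + u - Poly_Mapping.single i 1)
            (of_nat (poly_mapping.lookup t i) * c * d)"
      using single_diff_add_single[of t i u]
      by (cases "poly_mapping.lookup t i = 0") (auto simp: mpoly_pderiv_single mult_single)
    have 2: "Poly_Mapping.single t c * mpoly_pderiv i (Poly_Mapping.single u d)
        = Poly_Mapping.single (t + u - Poly_Mapping.single i 1)
            (of_nat (poly_mapping.lookup u i) * c * d)"
      using single_diff_add_single[of u i t]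
      by (cases "poly_mapping.lookup u i = 0")
        (auto simp: mpoly_pderiv_single mult_single add.commute mult_ac)
    show ?case
      unfolding 1 2 single_add[symmetric]
      by (simp add: mult_single mpoly_pderiv_single lookup_add algebra_simps)
  qed (simp_all add: mpoly_pderiv_add algebra_simps)
qed (simp_all add: mpoly_pderiv_add algebra_simps)

lemma mpoly_eval_superset:
  assumes "finite X" "Poly_Mapping.keys f \<subseteq> X"
  shows "mpoly_eval v f
    = (\<Sum>t\<in>X. poly_mapping.lookup f t
          * (\<Prod>i\<in>Poly_Mapping.keys t. v $ i ^ poly_mapping.lookup t i))"
  unfolding mpoly_eval_def
  by (rule sum.mono_neutral_left) (use assms in \<open>auto simp: in_keys_iff\<close>)

lemma mpoly_eval_0 [simp]: "mpoly_eval v 0 = 0"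
  by (simp add: mpoly_eval_def)

lemma mpoly_eval_add: "mpoly_eval v (f + g) = mpoly_eval v f + mpoly_eval v g"
proof -
  let ?X = "Poly_Mapping.keys f \<union> Poly_Mapping.keys g"
  have "Poly_Mapping.keys (f + g) \<subseteq> ?X" by (rule keys_add)
  then show ?thesis
    using mpoly_eval_superset[of ?X f v] mpoly_eval_superset[of ?X g v]
      mpoly_eval_superset[of ?X "f + g" v]
    by (simp add: lookup_add sum.distrib algebra_simps)
qed

lemma mpoly_eval_smult: "mpoly_eval v (mpoly_smult c f) = c * mpoly_eval v f"
proof -
  have "Poly_Mapping.keys (mpoly_smult c f) \<subseteq> Poly_Mapping.keys f"
    by (auto simp: in_keys_iff)
  then show ?thesis
    using mpoly_eval_superset[of "Poly_Mapping.keys f" "mpoly_smult c f" v]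
    by (simp add: mpoly_eval_def sum_distrib_left mult.assoc)
qed

lemma mpoly_eval_single:
  "mpoly_eval v (Poly_Mapping.single t c)
     = c * (\<Prod>i\<in>Poly_Mapping.keys t. v $ i ^ poly_mapping.lookup t i)"
  by (cases "c = 0") (simp_all add: mpoly_eval_def)

lemma mpoly_eval_mult: "mpoly_eval v (f * g) = mpoly_eval v f * mpoly_eval v g"
proof (induction f rule: mpoly_additive_induct)
  case (single t c)
  show ?case
  proof (induction g rule: mpoly_additive_induct)
    case (single u d)
    let ?X = "Poly_Mapping.keys t \<union> Poly_Mapping.keys u"
    have *: "(\<Prod>i\<in>Poly_Mapping.keys e. v $ i ^ poly_mapping.lookup e i)
        = (\<Prod>i\<in>?X. v $ i ^ poly_mapping.lookup e i)" if "Poly_Mapping.keys e \<subseteq> ?X" for e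
      by (rule prod.mono_neutral_left) (use that in \<open>auto simp: in_keys_iff\<close>)
    have "(\<Prod>i\<in>Poly_Mapping.keys (t + u). v $ i ^ poly_mapping.lookup (t + u) i)
        = (\<Prod>i\<in>Poly_Mapping.keys t. v $ i ^ poly_mapping.lookup t i)
          * (\<Prod>i\<in>Poly_Mapping.keys u. v $ i ^ poly_mapping.lookup u i)"
      using *[of t] *[of u] *[of "t + u"] keys_add[of t u]
      by (simp add: lookup_add power_add prod.distrib)
    then show ?case by (simp add: mult_single mpoly_eval_single)
  qed (simp_all add: mpoly_eval_add algebra_simps)
qed (simp_all add: mpoly_eval_add algebra_simps)

lemma mpoly_eval_sum: "mpoly_eval v (\<Sum>x\<in>X. g x) = (\<Sum>x\<in>X. mpoly_eval v (g x))"
  by (induction X rule: infinite_finite_induct) (simp_all add: mpoly_eval_add)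

lemma mpoly_smult_eq_mult: "mpoly_smult c f = mpoly_const c * f"
proof (induction f rule: mpoly_additive_induct)
  case (single t a)
  show ?case
    by (intro poly_mapping_eqI) (auto simp: mpoly_const_def mult_single lookup_single when_def)
next
  case (add f g)
  then show ?case by (simp add: mpoly.scale_right_distrib algebra_simps)
qed simp

section \<open>The order filtration at a point\<close>

text \<open>
  The order of vanishing is measured through first derivatives only, so that Leibniz's rule gives the
  behaviour under products by a plain induction. The lemma \<open>vanish_ge_iff_partial\<close> below translates
  this into the derivatives of all orders less than \<open>k\<close>.
\<close>

fun vanish_ge :: "nat \<Rightarrow> 'k::field vec \<Rightarrow> nat \<Rightarrow> 'k mpoly \<Rightarrow> bool" where
  "vanish_ge N b 0 f \<longleftrightarrow> True"
| "vanish_ge N b (Suc k) f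
     \<longleftrightarrow> mpoly_eval b f = 0 \<and> (\<forall>i\<le>N. vanish_ge N b k (mpoly_pderiv i f))"

lemma vanish_ge_0 [simp]: "vanish_ge N b k 0"
  by (induction k) auto

lemma vanish_ge_add: "vanish_ge N b k f \<Longrightarrow> vanish_ge N b k g \<Longrightarrow> vanish_ge N b k (f + g)"
  by (induction k arbitrary: f g) (auto simp: mpoly_eval_add mpoly_pderiv_add)

lemma vanish_ge_smult: "vanish_ge N b k f \<Longrightarrow> vanish_ge N b k (mpoly_smult c f)"
  by (induction k arbitrary: f) (auto simp: mpoly_eval_smult mpoly_pderiv_smult)

lemma vanish_ge_sum:
  "(\<And>x. x \<in> X \<Longrightarrow> vanish_ge N b k (g x)) \<Longrightarrow> vanish_ge N b k (\<Sum>x\<in>X. g x)"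
  by (induction X rule: infinite_finite_induct) (auto intro: vanish_ge_add)

lemma vanish_ge_Suc_imp: "vanish_ge N b (Suc k) f \<Longrightarrow> vanish_ge N b k f"
  by (induction k arbitrary: f) auto

lemma vanish_ge_mono: "j \<le> k \<Longrightarrow> vanish_ge N b k f \<Longrightarrow> vanish_ge N b j f"
proof (induction k rule: dec_induct)
  case (step n)
  then show ?case using vanish_ge_Suc_imp by blast
qed

lemma vanish_ge_pderiv:
  "i \<le> N \<Longrightarrow> vanish_ge N b k f \<Longrightarrow> vanish_ge N b (k - 1) (mpoly_pderiv i f)"
  by (cases k) auto

text \<open>
  By Leibniz's rule each derivative of the product loses one order in only one of the two factors. If
  that factor has order \<open>0\<close> to lose from, its derivative is unrestricted, and the other factor alone
  carries the claim.
\<close>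

lemma vanish_ge_mult:
  "vanish_ge N b k f \<Longrightarrow> vanish_ge N b l g \<Longrightarrow> vanish_ge N b (k + l) (f * g)"
proof (induction "k + l" arbitrary: k l f g)
  case (Suc n)
  have "mpoly_eval b (f * g) = 0"
    using Suc by (cases k; cases l) (auto simp: mpoly_eval_mult)
  moreover have "vanish_ge N b n (mpoly_pderiv i (f * g))" if "i \<le> N" for i
    unfolding mpoly_pderiv_mult
  proof (rule vanish_ge_add)
    show "vanish_ge N b n (mpoly_pderiv i f * g)"
    proof (cases k)
      case 0
      then show ?thesis
        using Suc.hyps Suc.prems by (metis add_0 vanish_ge.simps(1) vanish_ge_Suc_imp)
    next
      case (Suc k')
      then show ?thesis
        using Suc.hyps(1)[of k' l "mpoly_pderiv i f" g] Suc.hyps(2) Suc.prems that by auto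
    qed
    show "vanish_ge N b n (f * mpoly_pderiv i g)"
    proof (cases l)
      case 0
      then show ?thesis
        using Suc.hyps Suc.prems by (metis add_0_right vanish_ge.simps(1) vanish_ge_Suc_imp)
    next
      case (Suc l')
      then show ?thesis
        using Suc.hyps(1)[of k l' f "mpoly_pderiv i g"] Suc.hyps(2) Suc.prems that by auto
    qed
  qed
  ultimately show ?case
    unfolding Suc.hyps(2)[symmetric] by simp
qed simp

lemma vanish_ge_prod:
  "(\<And>x. x \<in> X \<Longrightarrow> vanish_ge N b (k x) (g x)) \<Longrightarrow> vanish_ge N b (\<Sum>x\<in>X. k x) (\<Prod>x\<in>X. g x)"
  by (induction X rule: infinite_finite_induct) (auto intro: vanish_ge_mult)

text \<open>
  Each permutation uses every row and every column once, so each product in the Leibniz expansion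
  collects all column orders and all row weights. The subtraction of naturals is harmless: it only
  rounds the order of an entry up to \<open>0\<close>.
\<close>

lemma vanish_ge_det:
  fixes b :: "'k::field vec"
  assumes A: "A \<in> carrier_mat n n"
    and entry: "\<And>i l. i < n \<Longrightarrow> l < n \<Longrightarrow> vanish_ge N b (\<omega> l - w i) (A $$ (i, l))"
  shows "vanish_ge N b ((\<Sum>l<n. \<omega> l) - (\<Sum>i<n. w i)) (det A)"
  unfolding det_def'[OF A]
proof (rule vanish_ge_sum)
  fix \<pi> assume "\<pi> \<in> {\<pi>. \<pi> permutes {0..<n}}"
  then have \<pi>: "\<pi> permutes {0..<n}" by simp
  have lt: "\<pi> i < n" if "i < n" for i
    using permutes_in_image[OF \<pi>, of i] that by simp
  have "vanish_ge N b (\<Sum>i=0..<n. \<omega> (\<pi> i) - w i) (\<Prod>i=0..<n. A $$ (i, \<pi> i))"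
    by (rule vanish_ge_prod) (use entry lt in auto)
  moreover have "(\<Sum>l<n. \<omega> l) - (\<Sum>i<n. w i) \<le> (\<Sum>i=0..<n. \<omega> (\<pi> i) - w i)"
  proof -
    have "(\<Sum>l<n. \<omega> l) = (\<Sum>i=0..<n. \<omega> (\<pi> i))"
      using sum.permute[OF \<pi>, of \<omega>] by (simp add: lessThan_atLeast0)
    also have "\<dots> \<le> (\<Sum>i=0..<n. (\<omega> (\<pi> i) - w i) + w i)"
      by (rule sum_mono) auto
    finally show ?thesis by (simp add: sum.distrib lessThan_atLeast0)
  qed
  ultimately have "vanish_ge N b ((\<Sum>l<n. \<omega> l) - (\<Sum>i<n. w i)) (\<Prod>i=0..<n. A $$ (i, \<pi> i))"
    using vanish_ge_mono by blast
  then show "vanish_ge N b ((\<Sum>l<n. \<omega> l) - (\<Sum>i<n. w i)) (signof \<pi> * (\<Prod>i=0..<n. A $$ (i, \<pi> i)))"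
    using vanish_ge_mult[of N b 0 "signof \<pi>"] by simp
qed

section \<open>Exponent vectors and forms\<close>

lemma exponents_0: "exponents N 0 = {0}"
  by (auto simp: exponents_def intro!: poly_mapping_eqI)
    (metis atMost_iff in_keys_iff subsetD)

lemma sum_lookup_add_single:
  fixes i :: nat
  shows "i \<le> N \<Longrightarrow> (\<Sum>j\<le>N. poly_mapping.lookup (e + Poly_Mapping.single i (k::nat)) j)
     = (\<Sum>j\<le>N. poly_mapping.lookup e j) + k"
  by (simp add: lookup_add lookup_single sum.distrib when_def)

lemma add_single_in_exponents_iff:
  assumes "i \<le> N"
  shows "e + Poly_Mapping.single i k \<in> exponents N r \<longleftrightarrow> k \<le> r \<and> e \<in> exponents N (r - k)"
proof -
  have "Poly_Mapping.keys (e + Poly_Mapping.single i k) \<subseteq> {..N} \<longleftrightarrow> Poly_Mapping.keys e \<subseteq> {..N}"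
    using assms by (auto simp: in_keys_iff lookup_add lookup_single when_def subset_iff)
  then show ?thesis
    using sum_lookup_add_single[OF assms, of e k] by (auto simp: exponents_def)
qed

lemma exponents_SucE:
  assumes "e \<in> exponents N (Suc r)"
  obtains i e' where "i \<le> N" "e' \<in> exponents N r" "e = e' + Poly_Mapping.single i 1"
proof -
  from assms have "(\<Sum>i\<le>N. poly_mapping.lookup e i) \<noteq> 0" by (simp add: exponents_def)
  then obtain i where i: "i \<le> N" "poly_mapping.lookup e i \<noteq> 0"
    by (metis atMost_iff sum.neutral)
  define e' where "e' = e - Poly_Mapping.single i 1"
  have "e = e' + Poly_Mapping.single i 1"
    unfolding e'_def using i(2)
    by (intro poly_mapping_eqI) (auto simp: lookup_add lookup_minus lookup_single when_def)
  then show ?thesis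
    using that i(1) assms add_single_in_exponents_iff[OF i(1), of e' 1 "Suc r"] by simp
qed

lemma lookup_le_of_exponents:
  assumes "e \<in> exponents N r" shows "poly_mapping.lookup e i \<le> r"
proof (cases "i \<le> N")
  case True
  then show ?thesis
    using assms member_le_sum[of i "{..N}" "poly_mapping.lookup e"] by (auto simp: exponents_def)
next
  case False
  then have "poly_mapping.lookup e i = 0"
    using assms by (auto simp: exponents_def subset_iff in_keys_iff)
  then show ?thesis by simp
qed

text \<open>
  Stars and bars: an exponent vector is the list of its \<open>N + 1\<close> entries, and these lists are counted
  in the library.
\<close>

lemma finite_card_exponents:
  "finite (exponents N k) \<and> card (exponents N k) = (k + N) choose N"
proof -
  define \<phi> where "\<phi> = (\<lambda>e::nat \<Rightarrow>\<^sub>0 nat. map (poly_mapping.lookup e) [0..<Suc N])"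
  have inj: "inj_on \<phi> (exponents N k)"
  proof (rule inj_onI, rule poly_mapping_eqI)
    fix e e' i assume e: "e \<in> exponents N k" "e' \<in> exponents N k" and eq: "\<phi> e = \<phi> e'"
    show "poly_mapping.lookup e i = poly_mapping.lookup e' i"
    proof (cases "i \<le> N")
      case True
      then show ?thesis using eq by (auto simp: \<phi>_def)
    next
      case False
      then have "i \<notin> Poly_Mapping.keys e" "i \<notin> Poly_Mapping.keys e'"
        using e by (auto simp: exponents_def)
      then show ?thesis by (simp add: in_keys_iff)
    qed
  qed
  have img: "\<phi> ` exponents N k = {l. length l = Suc N \<and> sum_list l = k}"
  proof (intro equalityI subsetI)
    fix l assume "l \<in> \<phi> ` exponents N k"
    then show "l \<in> {l. length l = Suc N \<and> sum_list l = k}"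
      by (auto simp: \<phi>_def exponents_def interv_sum_list_conv_sum_set_nat
          atLeast0_lessThan_Suc lessThan_atLeast0 atMost_atLeast0 atLeastLessThanSuc_atLeastAtMost
          simp del: upt_Suc)
  next
    fix l :: "nat list" assume l: "l \<in> {l. length l = Suc N \<and> sum_list l = k}"
    define e where "e = Abs_poly_mapping (\<lambda>i. if i \<le> N then l ! i else 0)"
    have "finite {i. (if i \<le> N then l ! i else 0) \<noteq> 0}"
      by (rule finite_subset[of _ "{..N}"]) auto
    then have e: "poly_mapping.lookup e i = (if i \<le> N then l ! i else 0)" for i
      by (simp add: e_def Abs_poly_mapping_inverse)
    have "\<phi> e = l"
      using l by (intro nth_equalityI) (auto simp: \<phi>_def e simp del: upt_Suc)
    moreover have "e \<in> exponents N k"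
      using l by (auto simp: exponents_def e in_keys_iff sum_list_sum_nth
          atLeastLessThanSuc_atLeastAtMost atMost_atLeast0 split: if_splits)
    ultimately show "l \<in> \<phi> ` exponents N k" by blast
  qed
  have card: "card (exponents N k) = (k + N) choose N"
    using card_image[OF inj] card_length_sum_list[of "Suc N" k] binomial_symmetric[of N "k + N"]
    unfolding img by simp
  moreover have "(k + N) choose N \<noteq> 0" by simp
  ultimately show ?thesis by (metis card.infinite)
qed

lemmas finite_exponents = conjunct1[OF finite_card_exponents]
lemmas card_exponents = conjunct2[OF finite_card_exponents]

text \<open>
  Subtracting \<open>k\<close> from the exponent of the variable \<open>i\<close> is a bijection onto the exponent vectors of
  total degree \<open>M - k\<close>.
\<close>

lemma card_exponents_ge:
  assumes "i \<le> N" "k \<le> M"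
  shows "card {e \<in> exponents N M. k \<le> poly_mapping.lookup e i} = (M - k + N) choose N"
proof -
  have "{e \<in> exponents N M. k \<le> poly_mapping.lookup e i}
      = (\<lambda>e. e + Poly_Mapping.single i k) ` exponents N (M - k)"
  proof (intro equalityI subsetI)
    fix e assume e: "e \<in> {e \<in> exponents N M. k \<le> poly_mapping.lookup e i}"
    define e' where "e' = e - Poly_Mapping.single i k"
    have "e = e' + Poly_Mapping.single i k"
      unfolding e'_def using e
      by (intro poly_mapping_eqI) (auto simp: lookup_add lookup_minus lookup_single when_def)
    then show "e \<in> (\<lambda>e. e + Poly_Mapping.single i k) ` exponents N (M - k)"
      using e add_single_in_exponents_iff[OF assms(1), of e' k M] by auto
  qed (use assms in \<open>auto simp: add_single_in_exponents_iff lookup_add\<close>)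
  then show ?thesis
    by (simp add: card_image card_exponents)
qed

text \<open>
  Layer-cake summation: \<open>f x\<close> is the number of levels \<open>j\<close> with \<open>1 \<le> j \<le> f x\<close>.
\<close>

lemma sum_eq_sum_card_ge:
  fixes f :: "'a \<Rightarrow> nat"
  assumes "finite X" "\<And>x. x \<in> X \<Longrightarrow> f x \<le> n"
  shows "(\<Sum>x\<in>X. f x) = (\<Sum>j=1..n. card {x \<in> X. j \<le> f x})"
proof -
  have "f x = (\<Sum>j=1..n. if j \<le> f x then 1 else 0)" if "x \<in> X" for x
  proof -
    have "{j \<in> {1..n}. j \<le> f x} = {1..f x}" using assms(2)[OF that] by auto
    then show ?thesis by (simp add: sum.If_cases Int_def)
  qed
  then have "(\<Sum>x\<in>X. f x) = (\<Sum>x\<in>X. \<Sum>j=1..n. if j \<le> f x then 1 else 0)" by simp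
  also have "\<dots> = (\<Sum>j=1..n. \<Sum>x\<in>X. if j \<le> f x then 1 else 0)" by (rule sum.swap)
  also have "\<dots> = (\<Sum>j=1..n. card {x \<in> X. j \<le> f x})"
    using assms(1) by (simp add: sum.If_cases Int_def)
  finally show ?thesis .
qed

lemma sum_lookup_exponents:
  assumes "i \<le> N"
  shows "(\<Sum>e\<in>exponents N M. poly_mapping.lookup e i) = (\<Sum>q<M. (q + N) choose N)"
proof -
  have "(\<Sum>e\<in>exponents N M. poly_mapping.lookup e i)
      = (\<Sum>j=1..M. card {e \<in> exponents N M. j \<le> poly_mapping.lookup e i})"
    by (rule sum_eq_sum_card_ge) (auto simp: finite_exponents lookup_le_of_exponents)
  also have "\<dots> = (\<Sum>j=1..M. (M - j + N) choose N)"
    by (rule sum.cong) (auto simp: card_exponents_ge assms)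
  also have "\<dots> = (\<Sum>q<M. (q + N) choose N)"
    by (rule sum.reindex_bij_witness[of _ "\<lambda>q. M - q" "\<lambda>j. M - j"]) auto
  finally show ?thesis .
qed

lemma forms_0: "0 \<in> forms N d"
  by (simp add: forms_def)

lemma forms_add: "f \<in> forms N d \<Longrightarrow> g \<in> forms N d \<Longrightarrow> f + g \<in> forms N d"
  using keys_add[of f g] by (auto simp: forms_def)

lemma forms_smult: "f \<in> forms N d \<Longrightarrow> mpoly_smult c f \<in> forms N d"
  by (auto simp: forms_def in_keys_iff subset_iff)

lemma forms_sum: "(\<And>x. x \<in> X \<Longrightarrow> g x \<in> forms N d) \<Longrightarrow> (\<Sum>x\<in>X. g x) \<in> forms N d"
  by (induction X rule: infinite_finite_induct) (auto intro: forms_add forms_0)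

lemma mpoly_pderiv_forms:
  assumes "f \<in> forms N d" "i \<le> N"
  shows "mpoly_pderiv i f \<in> forms N (d - 1)"
  unfolding forms_def
proof safe
  fix t assume "t \<in> Poly_Mapping.keys (mpoly_pderiv i f)"
  then have "t + Poly_Mapping.single i 1 \<in> Poly_Mapping.keys f"
    by (auto simp: in_keys_iff lookup_mpoly_pderiv)
  then show "t \<in> exponents N (d - 1)"
    using assms add_single_in_exponents_iff[OF assms(2), of t 1 d] by (auto simp: forms_def)
qed

lemma euler_formula:
  fixes f :: "'k::field mpoly"
  assumes "f \<in> forms N d"
  shows "(\<Sum>i\<le>N. Poly_Mapping.single (Poly_Mapping.single i 1) 1 * mpoly_pderiv i f)
    = mpoly_smult (of_nat d) f"
proof -
  let ?c = "poly_mapping.lookup f"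
  have "Poly_Mapping.single (Poly_Mapping.single i 1) 1 * mpoly_pderiv i f
      = (\<Sum>t\<in>Poly_Mapping.keys f. Poly_Mapping.single t (of_nat (poly_mapping.lookup t i) * ?c t))" for i
    unfolding mpoly_pderiv_def sum_distrib_left
  proof (rule sum.cong)
    fix t assume "t \<in> Poly_Mapping.keys f"
    show "Poly_Mapping.single (Poly_Mapping.single i 1) 1
        * Poly_Mapping.single (t - Poly_Mapping.single i 1) (of_nat (poly_mapping.lookup t i) * ?c t)
      = Poly_Mapping.single t (of_nat (poly_mapping.lookup t i) * ?c t)"
      using single_diff_add_single[of t i "Poly_Mapping.single i 1"]
      by (cases "poly_mapping.lookup t i = 0") (auto simp: mult_single add.commute)
  qed simp
  then have "(\<Sum>i\<le>N. Poly_Mapping.single (Poly_Mapping.single i 1) 1 * mpoly_pderiv i f)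
     = (\<Sum>t\<in>Poly_Mapping.keys f. \<Sum>i\<le>N. Poly_Mapping.single t (of_nat (poly_mapping.lookup t i) * ?c t))"
    by (simp add: sum.swap[of _ "{..N}"])
  also have "\<dots> = (\<Sum>t\<in>Poly_Mapping.keys f. mpoly_smult (of_nat d) (Poly_Mapping.single t (?c t)))"
  proof (rule sum.cong)
    fix t assume "t \<in> Poly_Mapping.keys f"
    then have "(\<Sum>i\<le>N. poly_mapping.lookup t i) = d"
      using assms by (auto simp: forms_def exponents_def)
    then have "(\<Sum>i\<le>N. of_nat (poly_mapping.lookup t i)) = (of_nat d :: 'k)"
      by (metis of_nat_sum)
    then show "(\<Sum>i\<le>N. Poly_Mapping.single t (of_nat (poly_mapping.lookup t i) * ?c t))
        = mpoly_smult (of_nat d) (Poly_Mapping.single t (?c t))"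
      by (intro poly_mapping_eqI)
        (auto simp: lookup_sum lookup_single when_def sum_distrib_right[symmetric])
  qed simp
  also have "\<dots> = mpoly_smult (of_nat d) f"
    unfolding mpoly.scale_sum_right[symmetric] by (simp add: mpoly_eq_sum_single[symmetric])
  finally show ?thesis .
qed

section \<open>Iterated commuting derivations\<close>

text \<open>
  The iteration of \<open>mpoly_partial\<close> for an arbitrary family of operators; it is used for the
  coordinate derivatives and for the derivatives adapted to a point.
\<close>

definition iter_deriv ::
    "(nat \<Rightarrow> 'k mpoly \<Rightarrow> 'k mpoly) \<Rightarrow> nat \<Rightarrow> (nat \<Rightarrow>\<^sub>0 nat) \<Rightarrow> 'k::zero mpoly \<Rightarrow> 'k mpoly" where
  "iter_deriv \<delta> N e = fold (\<lambda>i. \<delta> i ^^ poly_mapping.lookup e i) [0..<Suc N]"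

lemma mpoly_partial_eq_iter_deriv: "mpoly_partial N e = iter_deriv mpoly_pderiv N e"
  by (simp add: mpoly_partial_def iter_deriv_def del: upt_Suc)

lemma iter_deriv_0: "iter_deriv \<delta> N 0 f = f"
proof -
  have "fold (\<lambda>i. \<delta> i ^^ poly_mapping.lookup 0 i) xs f = f" for xs
    by (induction xs) auto
  then show ?thesis by (simp only: iter_deriv_def)
qed

text \<open>
  As the operators commute, one more application of \<open>\<delta> k\<close> can be carried out first. This turns
  statements on iterated derivatives into inductions on their order.
\<close>

lemma iter_deriv_add_single:
  assumes comm: "\<And>i j f. \<delta> i (\<delta> j f) = \<delta> j (\<delta> i f)" and "k \<le> N"
  shows "iter_deriv \<delta> N (e + Poly_Mapping.single k 1) f = iter_deriv \<delta> N e (\<delta> k f)"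
proof -
  have swap: "(\<delta> i ^^ n) (\<delta> j f) = \<delta> j ((\<delta> i ^^ n) f)" for i j n f
    by (induction n) (simp_all add: comm)
  have "fold (\<lambda>i. \<delta> i ^^ poly_mapping.lookup (e + Poly_Mapping.single k 1) i) xs f
      = fold (\<lambda>i. \<delta> i ^^ poly_mapping.lookup e i) xs (if k \<in> set xs then \<delta> k f else f)"
    if "distinct xs" for xs
    using that
  proof (induction xs arbitrary: f)
    case (Cons x xs)
    show ?case
    proof (cases "x = k")
      case True
      then show ?thesis
        using Cons by (simp add: lookup_add swap)
    next
      case False
      then show ?thesis
        using Cons by (simp add: lookup_add lookup_single_not_eq swap)
    qed
  qed simp
  from this[of "[0..<Suc N]"] show ?thesis
    using assms(2) by (simp add: iter_deriv_def less_Suc_eq_le del: upt_Suc)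
qed

lemma mpoly_partial_add_single:
  "k \<le> N \<Longrightarrow> mpoly_partial N (e + Poly_Mapping.single k 1) f = mpoly_partial N e (mpoly_pderiv k f)"
  unfolding mpoly_partial_eq_iter_deriv 
  by (rule iter_deriv_add_single) (rule mpoly_pderiv_commute)

lemma vanish_ge_iff_partial:
  "vanish_ge N b k f \<longleftrightarrow>
     (\<forall>r<k. \<forall>e\<in>exponents N r. mpoly_eval b (mpoly_partial N e f) = 0)"
proof (induction k arbitrary: f)
  case (Suc k)
  have "(\<forall>r<Suc k. \<forall>e\<in>exponents N r. mpoly_eval b (mpoly_partial N e f) = 0)
     \<longleftrightarrow> mpoly_eval b f = 0
        \<and> (\<forall>r<k. \<forall>e\<in>exponents N (Suc r). mpoly_eval b (mpoly_partial N e f) = 0)"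
    by (auto simp: exponents_0 mpoly_partial_eq_iter_deriv iter_deriv_0 less_Suc_eq_0_disj)
  also have "(\<forall>r<k. \<forall>e\<in>exponents N (Suc r). mpoly_eval b (mpoly_partial N e f) = 0)
     \<longleftrightarrow> (\<forall>i\<le>N. \<forall>r<k. \<forall>e\<in>exponents N r. mpoly_eval b (mpoly_partial N e (mpoly_pderiv i f)) = 0)"
    (is "?L \<longleftrightarrow> ?R")
  proof
    assume ?L
    show ?R
    proof (intro allI impI ballI)
      fix i r e assume "i \<le> N" "r < k" "e \<in> exponents N r"
      then show "mpoly_eval b (mpoly_partial N e (mpoly_pderiv i f)) = 0"
        using \<open>?L\<close> add_single_in_exponents_iff[of i N e 1 "Suc r"]
        by (simp flip: mpoly_partial_add_single)
    qed
  next
    assume ?R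
    show ?L
    proof (intro allI impI ballI)
      fix r e assume "r < k" "e \<in> exponents N (Suc r)"
      then show "mpoly_eval b (mpoly_partial N e f) = 0"
        using \<open>?R\<close> by (elim exponents_SucE) (simp add: mpoly_partial_add_single del: One_nat_def)
    qed
  qed
  finally show ?case by (simp add: Suc.IH)
qed simp

lemma vanishes_to_order_iff: "vanishes_to_order N j f P \<longleftrightarrow> (\<forall>b\<in>P. vanish_ge N b j f)"
  by (auto simp: vanishes_to_order_def vanishes_at_def vanish_ge_iff_partial)

section \<open>Derivations adapted to a point\<close>

definition dir_deriv :: "nat \<Rightarrow> 'k::field vec \<Rightarrow> 'k mpoly \<Rightarrow> 'k mpoly" where
  "dir_deriv N b f = (\<Sum>i\<le>N. mpoly_smult (b $ i) (mpoly_pderiv i f))"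

text \<open>
  Only the derivative with respect to the variable \<open>i0\<close> is exchanged, for the derivative in the
  direction of the vector \<open>b\<close>. If \<open>b $ i0 \<noteq> 0\<close>, the new derivatives span the same space as the
  coordinate derivatives.
\<close>

definition adapted_deriv :: "nat \<Rightarrow> 'k::field vec \<Rightarrow> nat \<Rightarrow> nat \<Rightarrow> 'k mpoly \<Rightarrow> 'k mpoly" where
  "adapted_deriv N b i0 = mpoly_pderiv(i0 := dir_deriv N b)"

abbreviation adapted_partial ::
    "nat \<Rightarrow> 'k::field vec \<Rightarrow> nat \<Rightarrow> (nat \<Rightarrow>\<^sub>0 nat) \<Rightarrow> 'k mpoly \<Rightarrow> 'k mpoly" where
  "adapted_partial N b i0 \<equiv> iter_deriv (adapted_deriv N b i0) N"

lemma mpoly_pderiv_sum: "mpoly_pderiv i (\<Sum>x\<in>X. g x) = (\<Sum>x\<in>X. mpoly_pderiv i (g x))"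
  by (induction X rule: infinite_finite_induct) (simp_all add: mpoly_pderiv_add)

lemma mpoly_pderiv_dir_deriv_commute:
  "mpoly_pderiv i (dir_deriv N b f) = dir_deriv N b (mpoly_pderiv i f)"
  by (simp add: dir_deriv_def mpoly_pderiv_sum mpoly_pderiv_smult mpoly_pderiv_commute[of i])

lemma adapted_deriv_commute:
  "adapted_deriv N b i0 i (adapted_deriv N b i0 j f)
     = adapted_deriv N b i0 j (adapted_deriv N b i0 i f)"
  by (simp add: adapted_deriv_def mpoly_pderiv_dir_deriv_commute mpoly_pderiv_commute)

lemma adapted_partial_add_single:
  "k \<le> N \<Longrightarrow> adapted_partial N b i0 (e + Poly_Mapping.single k 1) f
     = adapted_partial N b i0 e (adapted_deriv N b i0 k f)"
  by (rule iter_deriv_add_single) (rule adapted_deriv_commute)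

lemma adapted_deriv_add:
  "adapted_deriv N b i0 i (f + g) = adapted_deriv N b i0 i f + adapted_deriv N b i0 i g"
  by (simp add: adapted_deriv_def dir_deriv_def mpoly_pderiv_add
      mpoly.scale_right_distrib sum.distrib)

lemma adapted_deriv_smult:
  "adapted_deriv N b i0 i (mpoly_smult c f) = mpoly_smult c (adapted_deriv N b i0 i f)"
  by (simp add: adapted_deriv_def dir_deriv_def mpoly_pderiv_smult
      mpoly.scale_sum_right mult.commute)

lemma adapted_partial_linear:
  assumes "e \<in> exponents N r"
  shows "adapted_partial N b i0 e (f + g) = adapted_partial N b i0 e f + adapted_partial N b i0 e g
    \<and> adapted_partial N b i0 e (mpoly_smult c f) = mpoly_smult c (adapted_partial N b i0 e f)"
  using assms
proof (induction r arbitrary: e f g)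
  case 0
  then show ?case by (simp add: exponents_0 iter_deriv_0)
next
  case (Suc r)
  from Suc.prems obtain i e' where "i \<le> N" "e' \<in> exponents N r" "e = e' + Poly_Mapping.single i 1"
    by (rule exponents_SucE)
  then show ?case
    using Suc.IH[of e']
    by (simp add: adapted_partial_add_single adapted_deriv_add adapted_deriv_smult del: One_nat_def)
qed

lemma adapted_partial_sum:
  assumes "e \<in> exponents N r"
  shows "adapted_partial N b i0 e (\<Sum>x\<in>X. mpoly_smult (c x) (g x))
     = (\<Sum>x\<in>X. mpoly_smult (c x) (adapted_partial N b i0 e (g x)))"
proof -
  have "adapted_partial N b i0 e 0 = 0"
    using adapted_partial_linear[OF assms, of b i0 0 0 0] by simp
  then show ?thesis
    using adapted_partial_linear[OF assms, of b i0]
    by (induction X rule: infinite_finite_induct) simp_all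
qed

text \<open>
  The directional derivative \<open>\<Sum>i. b $ i * D i f\<close> differs from the Euler sum \<open>\<Sum>i. a i * D i f\<close>, which
  is a multiple of \<open>f\<close>, by \<open>\<Sum>i. (b $ i - a i) * D i f\<close>. The order that is lost in \<open>D i f\<close> is regained
  in the factor \<open>b $ i - a i\<close>, which vanishes at \<open>b\<close>.
\<close>

lemma vanish_ge_dir_deriv:
  assumes f: "f \<in> forms N d" "vanish_ge N b k f"
  shows "vanish_ge N b k (dir_deriv N b f)"
proof -
  let ?x = "\<lambda>i. Poly_Mapping.single (Poly_Mapping.single i 1) 1 :: 'a mpoly"
  have "dir_deriv N b f = mpoly_smult (of_nat d) f
      + (\<Sum>i\<le>N. (mpoly_const (b $ i) - ?x i) * mpoly_pderiv i f)"
    unfolding euler_formula[OF f(1), symmetric] dir_deriv_def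
    unfolding mpoly_smult_eq_mult
    by (simp add: sum.distrib[symmetric] algebra_simps)
  moreover have "vanish_ge N b k ((mpoly_const (b $ i) - ?x i) * mpoly_pderiv i f)" if "i \<le> N" for i
  proof -
    have "mpoly_eval b (mpoly_const (b $ i) - ?x i) = 0"
    proof -
      have "mpoly_eval b (mpoly_const (b $ i) - ?x i + ?x i) = b $ i"
        by (simp add: mpoly_const_def mpoly_eval_single)
      moreover have "mpoly_eval b (?x i) = b $ i"
        by (simp add: mpoly_eval_single)
      ultimately show ?thesis unfolding mpoly_eval_add by simp
    qed
    then have "vanish_ge N b 1 (mpoly_const (b $ i) - ?x i)" by simp
    from vanish_ge_mult[OF this vanish_ge_pderiv[OF that f(2)]] show ?thesis
      by (rule vanish_ge_mono[rotated]) simp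
  qed
  ultimately show ?thesis
    using f(2) by (auto intro!: vanish_ge_add vanish_ge_smult vanish_ge_sum)
qed

text \<open>
  Of the \<open>r\<close> derivations, the radial ones cost nothing and each of the others costs one order. The
  homogeneity of \<open>f\<close> has to be carried along, since the radial step rests on Euler's formula.
\<close>

lemma vanish_ge_adapted_partial:
  assumes "e \<in> exponents N r" "f \<in> forms N d" "vanish_ge N b k f"
  shows "vanish_ge N b (k - (r - poly_mapping.lookup e i0)) (adapted_partial N b i0 e f)"
  using assms
proof (induction r arbitrary: e f d k)
  case 0
  then show ?case by (simp add: exponents_0 iter_deriv_0)
next
  case (Suc r)
  from Suc.prems(1) obtain i e' where i: "i \<le> N" "e' \<in> exponents N r"
    and e: "e = e' + Poly_Mapping.single i 1"
    by (rule exponents_SucE)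
  have step: "adapted_partial N b i0 e f = adapted_partial N b i0 e' (adapted_deriv N b i0 i f)"
    unfolding e by (rule adapted_partial_add_single[OF i(1)])
  show ?case
  proof (cases "i = i0")
    case True
    have "dir_deriv N b f \<in> forms N (d - 1)"
      unfolding dir_deriv_def
      by (intro forms_sum forms_smult mpoly_pderiv_forms Suc.prems(2)) simp
    moreover have \<delta>: "adapted_deriv N b i0 i f = dir_deriv N b f"
      using True by (simp add: adapted_deriv_def)
    ultimately show ?thesis
      using Suc.IH[OF i(2) _ vanish_ge_dir_deriv[OF Suc.prems(2,3)]]
      unfolding step \<delta> using True by (simp add: e lookup_add)
  next
    case False
    then have \<delta>: "adapted_deriv N b i0 i f = mpoly_pderiv i f"
      by (simp add: adapted_deriv_def)
    have "poly_mapping.lookup e' i0 \<le> r" by (rule lookup_le_of_exponents[OF i(2)])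
    with Suc.IH[OF i(2) mpoly_pderiv_forms[OF Suc.prems(2) i(1)] vanish_ge_pderiv[OF i(1) Suc.prems(3)]]
    show ?thesis
      unfolding step \<delta> using False
      by (simp add: e lookup_add lookup_single_not_eq Suc_diff_le)
  qed
qed

lemma mpoly_pderiv_eq_adapted:
  assumes "i \<le> N" "i0 \<le> N" "b $ i0 \<noteq> 0"
  shows "\<exists>c. \<forall>f. mpoly_pderiv i f = (\<Sum>j\<le>N. mpoly_smult (c j) (adapted_deriv N b i0 j f))"
proof (cases "i = i0")
  case False
  have "mpoly_pderiv i f
      = (\<Sum>j\<le>N. mpoly_smult (if j = i then 1 else 0) (adapted_deriv N b i0 j f))" for f
  proof -
    have "(\<Sum>j\<le>N. mpoly_smult (if j = i then 1 else 0) (adapted_deriv N b i0 j f))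
        = (\<Sum>j\<le>N. if j = i then adapted_deriv N b i0 j f else 0)"
      by (rule sum.cong) auto
    then show ?thesis using assms(1) False by (simp add: adapted_deriv_def)
  qed
  then show ?thesis by (intro exI[of _ "\<lambda>j. if j = i then 1 else 0"] allI)
next
  case True
  \<comment> \<open>From \<open>dir_deriv N b f = \<Sum>j. b $ j * D j f\<close> one obtains
    \<open>D i0 f = (dir_deriv N b f - \<Sum>j\<noteq>i0. b $ j * D j f) / b $ i0\<close>.\<close>
  define c where "c = (\<lambda>j. if j = i0 then inverse (b $ i0) else - inverse (b $ i0) * b $ j)"
  have "mpoly_pderiv i f = (\<Sum>j\<le>N. mpoly_smult (c j) (adapted_deriv N b i0 j f))" for f
  proof -
    have split: "(\<Sum>j\<le>N. g j) = g i0 + (\<Sum>j\<in>{..N} - {i0}. g j)" for g :: "nat \<Rightarrow> 'a mpoly"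
      using assms(2) by (intro sum.remove) auto
    have "(\<Sum>j\<le>N. mpoly_smult (c j) (adapted_deriv N b i0 j f))
        = mpoly_smult (inverse (b $ i0)) (dir_deriv N b f)
          + (\<Sum>j\<in>{..N} - {i0}. mpoly_smult (- inverse (b $ i0) * b $ j) (mpoly_pderiv j f))"
      unfolding split by (simp add: c_def adapted_deriv_def)
    also have "\<dots> = mpoly_smult (inverse (b $ i0)) (mpoly_smult (b $ i0) (mpoly_pderiv i0 f))"
      unfolding dir_deriv_def split
      by (simp add: mpoly.scale_right_distrib mpoly.scale_sum_right sum_negf)
    also have "\<dots> = mpoly_pderiv i f" using True assms(3) by simp
    finally show ?thesis by simp
  qed
  then show ?thesis by blast
qed

text \<open>
  The coefficients \<open>u\<close> do not depend on \<open>f\<close>: they become the rows of a constant matrix. The induction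
  expands the last derivative in the adapted ones and collects equal exponent vectors.
\<close>

lemma mpoly_partial_eq_adapted:
  assumes "i0 \<le> N" "b $ i0 \<noteq> 0" "e \<in> exponents N r"
  shows "\<exists>u. \<forall>f. mpoly_partial N e f
    = (\<Sum>e'\<in>exponents N r. mpoly_smult (u e') (adapted_partial N b i0 e' f))"
  using assms(3)
proof (induction r arbitrary: e)
  case 0
  then show ?case
    by (auto simp: exponents_0 iter_deriv_0 mpoly_partial_eq_iter_deriv intro!: exI[of _ "\<lambda>_. 1"])
next
  case (Suc r)
  from Suc.prems obtain i e1 where i: "i \<le> N" "e1 \<in> exponents N r"
    and e: "e = e1 + Poly_Mapping.single i 1"
    by (rule exponents_SucE)
  obtain u where u: "\<And>f. mpoly_partial N e1 f
      = (\<Sum>e'\<in>exponents N r. mpoly_smult (u e') (adapted_partial N b i0 e' f))"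
    using Suc.IH[OF i(2)] by blast
  obtain c where c: "\<And>f. mpoly_pderiv i f = (\<Sum>j\<le>N. mpoly_smult (c j) (adapted_deriv N b i0 j f))"
    using mpoly_pderiv_eq_adapted[OF i(1) assms(1,2)] by blast
  let ?X = "exponents N r \<times> {..N}"
  let ?h = "\<lambda>(e', j). e' + Poly_Mapping.single j 1"
  define v where "v = (\<lambda>e''. \<Sum>x\<in>{x\<in>?X. ?h x = e''}. u (fst x) * c (snd x))"
  have "mpoly_partial N e f
      = (\<Sum>e''\<in>exponents N (Suc r). mpoly_smult (v e'') (adapted_partial N b i0 e'' f))" for f
  proof -
    have "mpoly_partial N e f = (\<Sum>e'\<in>exponents N r. mpoly_smult (u e')
        (adapted_partial N b i0 e' (\<Sum>j\<le>N. mpoly_smult (c j) (adapted_deriv N b i0 j f))))"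
      unfolding e mpoly_partial_add_single[OF i(1)] u c ..
    also have "\<dots> = (\<Sum>e'\<in>exponents N r. \<Sum>j\<le>N. mpoly_smult (u e' * c j)
        (adapted_partial N b i0 (e' + Poly_Mapping.single j 1) f))"
      by (intro sum.cong refl)
        (simp add: adapted_partial_sum mpoly.scale_sum_right adapted_partial_add_single
          del: One_nat_def)
    also have "\<dots> = (\<Sum>x\<in>?X. mpoly_smult (u (fst x) * c (snd x)) (adapted_partial N b i0 (?h x) f))"
      by (simp add: sum.cartesian_product case_prod_beta)
    also have "\<dots> = (\<Sum>e''\<in>exponents N (Suc r). \<Sum>x\<in>{x\<in>?X. ?h x = e''}.
        mpoly_smult (u (fst x) * c (snd x)) (adapted_partial N b i0 (?h x) f))"
      by (rule sum.group[symmetric])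
        (auto simp: finite_exponents add_single_in_exponents_iff simp del: One_nat_def)
    also have "\<dots> = (\<Sum>e''\<in>exponents N (Suc r). mpoly_smult (v e'') (adapted_partial N b i0 e'' f))"
      unfolding v_def mpoly.scale_sum_left by (intro sum.cong refl) auto
    finally show ?thesis .
  qed
  then show ?case by blast
qed

section \<open>Bases adapted to a descending chain\<close>

text \<open>
  Choose a basis of the smallest set of the chain and extend it step by step to the larger ones.
  The value \<open>\<omega> f\<close> is the index at which \<open>f\<close> was added. The basis elements with \<open>\<omega> f \<ge> j\<close> are a
  maximal independent subset of \<open>W j\<close>, which gives the formula for the sum.
\<close>

lemma (in vector_space) adapted_basis:
  assumes "\<And>j. j < n \<Longrightarrow> W (Suc j) \<subseteq> W j" "finite S" "W 0 \<subseteq> span S"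
  shows "\<exists>A \<omega>. A \<subseteq> W 0 \<and> independent A \<and> W 0 \<subseteq> span A \<and> (\<forall>f\<in>A. f \<in> W (\<omega> f))
    \<and> (\<Sum>f\<in>A. \<omega> f) = (\<Sum>j=1..n. dim (W j))"
  using assms
proof (induction n arbitrary: W)
  case 0
  obtain A where "A \<subseteq> W 0" "independent A" "W 0 \<subseteq> span A"
    using maximal_independent_subset[of "W 0"] by blast
  then show ?case by (intro exI[of _ A] exI[of _ "\<lambda>_. 0"]) auto
next
  case (Suc n)
  have "W (Suc 0) \<subseteq> W 0" using Suc.prems(1) by simp
  then have "W (Suc 0) \<subseteq> span S" using Suc.prems(3) by blast
  then obtain A' \<omega>' where A': "A' \<subseteq> W (Suc 0)" "independent A'" "W (Suc 0) \<subseteq> span A'"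
      "\<forall>f\<in>A'. f \<in> W (Suc (\<omega>' f))" "(\<Sum>f\<in>A'. \<omega>' f) = (\<Sum>j=1..n. dim (W (Suc j)))"
    using Suc.IH[of "\<lambda>j. W (Suc j)"] Suc.prems by auto
  obtain A where A: "A' \<subseteq> A" "A \<subseteq> W 0" "independent A" "W 0 \<subseteq> span A"
    using maximal_independent_subset_extend[of A' "W 0"] A' \<open>W (Suc 0) \<subseteq> W 0\<close> by blast
  have fin: "finite A"
    using independent_span_bound[OF Suc.prems(2) A(3)] A(2) Suc.prems(3) by blast
  define \<omega> where "\<omega> = (\<lambda>f. if f \<in> A' then Suc (\<omega>' f) else 0)"
  have "(\<Sum>f\<in>A. \<omega> f) = (\<Sum>f\<in>A'. Suc (\<omega>' f))"
    using A(1) fin by (simp add: \<omega>_def sum.If_cases Int_absorb1)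
  also have "\<dots> = dim (W (Suc 0)) + (\<Sum>j=1..n. dim (W (Suc j)))"
    using A'(5) basis_card_eq_dim[OF A'(1,3,2)] sum.distrib[of "\<lambda>_. 1" \<omega>' A'] by simp
  also have "\<dots> = (\<Sum>j=1..Suc n. dim (W j))"
    using sum.atLeast_Suc_atMost[of 0 n "\<lambda>j. dim (W (Suc j))"]
    by (simp add: sum.shift_bounds_cl_Suc_ivl del: sum.cl_ivl_Suc)
  finally show ?case
    using A A'(4) by (intro exI[of _ A] exI[of _ \<omega>]) (auto simp: \<omega>_def)
qed

lemma forms_eq_span_monomials:
  "forms N d \<subseteq> mpoly.span ((\<lambda>t. Poly_Mapping.single t (1::'k::field)) ` exponents N d)"
proof
  fix f :: "'k mpoly" assume f: "f \<in> forms N d"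
  have "Poly_Mapping.single t c \<in> mpoly.span ((\<lambda>t. Poly_Mapping.single t (1::'k)) ` exponents N d)"
    if "t \<in> exponents N d" for t c
  proof -
    have "Poly_Mapping.single t c = mpoly_smult c (Poly_Mapping.single t 1)"
      by (intro poly_mapping_eqI) (simp add: lookup_single when_def)
    then show ?thesis using that by (auto intro: mpoly.span_scale mpoly.span_base)
  qed
  then have "(\<Sum>t\<in>Poly_Mapping.keys f. Poly_Mapping.single t (poly_mapping.lookup f t))
      \<in> mpoly.span ((\<lambda>t. Poly_Mapping.single t (1::'k)) ` exponents N d)"
    using f by (intro mpoly.span_sum) (auto simp: forms_def)
  then show "f \<in> mpoly.span ((\<lambda>t. Poly_Mapping.single t 1) ` exponents N d)"
    by (simp add: mpoly_eq_sum_single[symmetric])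
qed

lemma dim_forms: "mpoly.dim (forms N d :: 'k::field mpoly set) = (d + N) choose N"
proof -
  let ?x = "\<lambda>t. Poly_Mapping.single t (1::'k)"
  have inj: "inj_on ?x (exponents N d)"
    by (rule inj_onI) (metis lookup_single_eq lookup_single_not_eq one_neq_zero)
  have "mpoly.independent (?x ` exponents N d)"
  proof (rule mpoly.independent_if_scalars_zero)
    fix c g assume 0: "(\<Sum>g\<in>?x ` exponents N d. mpoly_smult (c g) g) = 0"
      and "g \<in> ?x ` exponents N d"
    then obtain t where t: "t \<in> exponents N d" "g = ?x t" by blast
    have "0 = poly_mapping.lookup (\<Sum>u\<in>exponents N d. mpoly_smult (c (?x u)) (?x u)) t"
      using 0 by (simp add: sum.reindex[OF inj])
    also have "\<dots> = c g"
      using t by (simp add: lookup_sum lookup_single when_def finite_exponents if_distrib cong: if_cong)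
    finally show "c g = 0" by simp
  qed (simp add: finite_exponents)
  moreover have "?x ` exponents N d \<subseteq> forms N d" by (auto simp: forms_def)
  ultimately have "mpoly.dim (forms N d :: 'k mpoly set) = card (?x ` exponents N d)"
    using mpoly.basis_card_eq_dim forms_eq_span_monomials by metis
  then show ?thesis by (simp add: card_image[OF inj] card_exponents)
qed

section \<open>The interpolation determinant\<close>

lemma sum_lessThan_add:
  fixes g :: "nat \<Rightarrow> 'a::comm_monoid_add"
  shows "(\<Sum>i<s + n. g i) = (\<Sum>i<s. g i) + (\<Sum>i<n. g (s + i))"
  by (induction n) (simp_all add: add.assoc)

lemma sum_set_eq_sum_nth:
  "distinct xs \<Longrightarrow> (\<Sum>x\<in>set xs. g x) = (\<Sum>i<length xs. g (xs ! i))"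
  by (rule sum.reindex_bij_betw[symmetric]) (rule bij_betw_nth; simp)

lemma mpoly_eval_sum_smult:
  "mpoly_eval v (\<Sum>x\<in>X. mpoly_smult (c x) (g x)) = (\<Sum>x\<in>X. c x * mpoly_eval v (g x))"
  by (simp add: mpoly_eval_sum mpoly_eval_smult)

lemma mpoly_const_sum_mult:
  "mpoly_const (\<Sum>x\<in>X. c x * (g x :: 'k::field)) = (\<Sum>x\<in>X. mpoly_smult (c x) (mpoly_const (g x)))"
  by (induction X rule: infinite_finite_induct)
    (simp_all add: mpoly_smult_eq_mult mpoly_const_def single_add mult_single)

text \<open>
  The weights add up to \<open>M * C(M+N,N)\<close> minus the sum of all exponents of \<open>i0\<close>. The summand for
  \<open>j = Suc M\<close> on the right-hand side is \<open>0\<close>; it is included to match the range of \<open>j\<close> in \<open>h_at\<close>.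
\<close>

lemma sum_adapted_weights:
  assumes "i0 \<le> N"
  shows "int (\<Sum>e\<in>exponents N M. M - poly_mapping.lookup e i0)
    = (\<Sum>j=1..Suc M. int ((M + N) choose N) - int ((j + N - 1) choose N))"
proof -
  have "int (\<Sum>e\<in>exponents N M. M - poly_mapping.lookup e i0)
      = (\<Sum>e\<in>exponents N M. int M - int (poly_mapping.lookup e i0))"
    by (simp add: of_nat_diff lookup_le_of_exponents)
  also have "\<dots> = int M * int ((M + N) choose N) - (\<Sum>q<M. int ((q + N) choose N))"
    by (simp add: sum_subtractf card_exponents sum_lookup_exponents[OF assms] flip: of_nat_sum)
  also have "\<dots> = (\<Sum>q<Suc M. int ((M + N) choose N) - int ((q + N) choose N))"
    by (simp add: sum_subtractf algebra_simps)
  also have "\<dots> = (\<Sum>j=1..Suc M. int ((M + N) choose N) - int ((j + N - 1) choose N))"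
    by (rule sum.reindex_bij_witness[of _ "\<lambda>j. j - 1" Suc]) auto
  finally show ?thesis .
qed

lemma linsys_subset_forms: "linsys N d j B Z \<subseteq> forms N d"
  by (auto simp: linsys_def)

lemma linsys_Suc_subset: "linsys N d (Suc j) B Z \<subseteq> linsys N d j B Z"
  by (auto simp: linsys_def vanishes_to_order_def intro: less_SucI)

text \<open>
  The columns of \<open>Q\<close> express the monomials in the basis \<open>fs\<close>, and the rows of \<open>U\<close> express the
  coordinate derivatives in the adapted ones. All that matters about \<open>U\<close> and \<open>Q\<close> is that they exist:
  their determinants, zero or not, do not decrease the order of a product.
\<close>

lemma interp_matrix_factorization:
  fixes p :: "nat \<Rightarrow> 'k::field vec" and fs :: "'k mpoly list"
  assumes C: "(d + N) choose N = ((M + N) choose N) + s"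
    and mons: "distinct mons" "set mons = exponents N d"
    and ders: "distinct ders" "set ders = exponents N M"
    and i0: "i0 \<le> N" "b $ i0 \<noteq> 0"
    and fs: "distinct fs" "length fs = (d + N) choose N" "forms N d \<subseteq> mpoly.span (set fs)"
  defines "n \<equiv> (d + N) choose N"
  defines "A \<equiv> mat n n (\<lambda>(i, k). if i < s then mpoly_const (mpoly_eval (p i) (fs ! k))
              else adapted_partial N b i0 (ders ! (i - s)) (fs ! k))"
  shows "\<exists>U\<in>carrier_mat n n. \<exists>Q\<in>carrier_mat n n. interp_matrix N d s p mons ders = U * A * Q"
proof -
  have len: "length mons = n" "length ders = (M + N) choose N"
    using mons ders by (metis distinct_card card_exponents n_def)+
  have n: "n = s + length ders" using C len by (simp add: n_def)
  have der_mem: "ders ! i \<in> exponents N M" if "i < length ders" for i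
    using that ders(2) nth_mem by blast
  define \<Phi> where "\<Phi> = (\<lambda>i f. if i < s then mpoly_const (mpoly_eval (p i) f)
      else mpoly_partial N (ders ! (i - s)) f)"
  define \<Psi> where "\<Psi> = (\<lambda>i f. if i < s then mpoly_const (mpoly_eval (p i) f)
      else adapted_partial N b i0 (ders ! (i - s)) f)"
  have "\<exists>u. \<forall>f. mpoly_partial N e f
      = (\<Sum>i<length ders. mpoly_smult (u i) (adapted_partial N b i0 (ders ! i) f))"
    if "e \<in> exponents N M" for e
  proof -
    obtain u where u: "\<And>f. mpoly_partial N e f
        = (\<Sum>e'\<in>exponents N M. mpoly_smult (u e') (adapted_partial N b i0 e' f))"
      using mpoly_partial_eq_adapted[OF i0 \<open>e \<in> exponents N M\<close>] by blast
    show ?thesis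
      unfolding u ders(2)[symmetric] sum_set_eq_sum_nth[OF ders(1)]
      by (intro exI[of _ "\<lambda>i. u (ders ! i)"] allI refl)
  qed
  then obtain u where u: "\<And>e f. e \<in> exponents N M \<Longrightarrow> mpoly_partial N e f
      = (\<Sum>i<length ders. mpoly_smult (u e i) (adapted_partial N b i0 (ders ! i) f))"
    by metis
  define U where "U = mat n n (\<lambda>(i, k). mpoly_const
      (if i < s then if k = i then 1 else 0 else if k < s then 0 else u (ders ! (i - s)) (k - s)))"
  have \<Phi>: "\<Phi> i f = (\<Sum>k<n. U $$ (i, k) * \<Psi> k f)" if i: "i < n" for i f
  proof (cases "i < s")
    case True
    have "(\<Sum>k<n. U $$ (i, k) * \<Psi> k f) = (\<Sum>k<n. if k = i then \<Psi> i f else 0)"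
      by (rule sum.cong) (use True i in \<open>auto simp: U_def mpoly_const_def\<close>)
    then show ?thesis using True i by (simp add: \<Phi>_def \<Psi>_def)
  next
    case False
    have "(\<Sum>k<n. U $$ (i, k) * \<Psi> k f)
       = (\<Sum>k<length ders. mpoly_smult (u (ders ! (i - s)) k) (adapted_partial N b i0 (ders ! k) f))"
      unfolding n sum_lessThan_add using False i
      by (simp add: U_def n \<Psi>_def mpoly_smult_eq_mult) (simp add: mpoly_const_def)
    then show ?thesis
      using False i u[OF der_mem[of "i - s"]] by (simp add: \<Phi>_def n)
  qed
  have "\<exists>q. Poly_Mapping.single (mons ! l) 1 = (\<Sum>k<n. mpoly_smult (q k) (fs ! k))" if "l < n" for l
  proof -
    have "mons ! l \<in> exponents N d"
      using that len(1) mons(2) nth_mem by metis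
    then have "Poly_Mapping.single (mons ! l) 1 \<in> forms N d" by (simp add: forms_def)
    then have "Poly_Mapping.single (mons ! l) 1 \<in> mpoly.span (set fs)" using fs(3) by blast
    then obtain q where "Poly_Mapping.single (mons ! l) 1 = (\<Sum>f\<in>set fs. mpoly_smult (q f) f)"
      by (auto simp: mpoly.span_finite)
    then show ?thesis
      unfolding sum_set_eq_sum_nth[OF fs(1)] fs(2) n_def[symmetric]
      by (intro exI[of _ "\<lambda>k. q (fs ! k)"])
  qed
  then obtain q where q: "\<And>l. l < n \<Longrightarrow>
      Poly_Mapping.single (mons ! l) 1 = (\<Sum>k<n. mpoly_smult (q l k) (fs ! k))"
    by metis
  define Q where "Q = mat n n (\<lambda>(k, l). mpoly_const (q l k))"
  have \<Psi>: "\<Psi> i (\<Sum>k<n. mpoly_smult (c k) (fs ! k)) = (\<Sum>k<n. mpoly_smult (c k) (\<Psi> i (fs ! k)))"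
    if "i < n" for i c
  proof (cases "i < s")
    case True
    then show ?thesis by (simp add: \<Psi>_def mpoly_eval_sum_smult mpoly_const_sum_mult)
  next
    case False
    with that have "ders ! (i - s) \<in> exponents N M" by (intro der_mem) (simp add: n)
    from adapted_partial_sum[OF this] show ?thesis using False by (simp add: \<Psi>_def)
  qed
  have carrier: "U \<in> carrier_mat n n" "A \<in> carrier_mat n n" "Q \<in> carrier_mat n n"
    by (simp_all add: U_def A_def Q_def)
  have "interp_matrix N d s p mons ders = U * (A * Q)"
  proof (rule eq_matI)
    fix i l assume "i < dim_row (U * (A * Q))" "l < dim_col (U * (A * Q))"
    then have il: "i < n" "l < n" using carrier by auto
    have AQ: "(A * Q) $$ (k, l) = \<Psi> k (Poly_Mapping.single (mons ! l) 1)" if k: "k < n" for k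
    proof -
      have "(A * Q) $$ (k, l) = (\<Sum>j<n. A $$ (k, j) * Q $$ (j, l))"
        using carrier k il by (simp add: scalar_prod_def lessThan_atLeast0)
      also have "\<dots> = (\<Sum>j<n. mpoly_smult (q l j) (\<Psi> k (fs ! j)))"
        using k il by (intro sum.cong) (auto simp: A_def Q_def \<Psi>_def mpoly_smult_eq_mult mult.commute)
      also have "\<dots> = \<Psi> k (Poly_Mapping.single (mons ! l) 1)"
        unfolding q[OF il(2)] \<Psi>[OF k] ..
      finally show ?thesis .
    qed
    have "(U * (A * Q)) $$ (i, l) = (\<Sum>k<n. U $$ (i, k) * (A * Q) $$ (k, l))"
      using carrier il by (simp add: scalar_prod_def lessThan_atLeast0 del: index_mult_mat(1))
         (simp add: scalar_prod_def lessThan_atLeast0)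
    also have "\<dots> = \<Phi> i (Poly_Mapping.single (mons ! l) 1)"
      using il AQ by (simp add: \<Phi>)
    finally show "interp_matrix N d s p mons ders $$ (i, l) = (U * (A * Q)) $$ (i, l)"
      using il by (simp add: interp_matrix_def \<Phi>_def Let_def n_def)
  qed (use carrier in \<open>auto simp: interp_matrix_def n_def\<close>)
  also have "\<dots> = U * A * Q" by (rule assoc_mult_mat[OF carrier, symmetric])
  finally show ?thesis using carrier(1,3) by blast
qed

text \<open>
  The chain used here starts with the space of all forms instead of \<open>L(d; 0B + Z)\<close>, so that a basis
  adapted to it has as many elements as there are monomials.
\<close>

lemma vanish_ge_interp_det:
  fixes p :: "nat \<Rightarrow> 'k::field vec"
  assumes "m \<ge> 1" "d \<ge> m"
    and C: "(d + N) choose N = ((m + N - 1) choose N) + s"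
    and p: "\<And>i. i < s \<Longrightarrow> p i \<in> P i"
    and mons: "distinct mons" "set mons = exponents N d"
    and ders: "distinct ders" "set ders = exponents N (m - 1)"
    and b: "b \<in> B" "i0 \<le> N" "b $ i0 \<noteq> 0"
  shows "vanish_ge N b (nat (h_total N d m s (P ` {..<s}) B)) (det (interp_matrix N d s p mons ders))"
proof -
  define Z where "Z = P ` {..<s}"
  define n where "n = (d + N) choose N"
  obtain M where M: "m = Suc M" using \<open>m \<ge> 1\<close> by (cases m) auto
  define W where "W = (\<lambda>j. if j = 0 then forms N d else linsys N d j B Z)"
  have "\<exists>A \<omega>. A \<subseteq> W 0 \<and> mpoly.independent A \<and> W 0 \<subseteq> mpoly.span A \<and> (\<forall>f\<in>A. f \<in> W (\<omega> f))
      \<and> (\<Sum>f\<in>A. \<omega> f) = (\<Sum>j=1..d. mpoly.dim (W j))"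
  proof (rule mpoly.adapted_basis)
    show "W (Suc j) \<subseteq> W j" for j
      using linsys_Suc_subset[of N d j B Z] linsys_subset_forms[of N d "Suc 0" B Z]
      by (auto simp: W_def)
    show "W 0 \<subseteq> mpoly.span ((\<lambda>t. Poly_Mapping.single t 1) ` exponents N d)"
      using forms_eq_span_monomials by (auto simp: W_def)
  qed (simp add: finite_exponents)
  then obtain X \<omega> where *: "X \<subseteq> W 0 \<and> mpoly.independent X \<and> W 0 \<subseteq> mpoly.span X
      \<and> (\<forall>f\<in>X. f \<in> W (\<omega> f)) \<and> (\<Sum>f\<in>X. \<omega> f) = (\<Sum>j=1..d. mpoly.dim (W j))"
    by (elim exE)
  moreover have "W 0 = forms N d" by (simp add: W_def)
  ultimately have X: "X \<subseteq> forms N d" "mpoly.independent X" "forms N d \<subseteq> mpoly.span X"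
    and X_W: "\<And>f. f \<in> X \<Longrightarrow> f \<in> W (\<omega> f)"
    and X_sum: "(\<Sum>f\<in>X. \<omega> f) = (\<Sum>j=1..d. mpoly.dim (W j))"
    by (simp_all only:) blast+
  have cardX: "card X = n"
    using mpoly.basis_card_eq_dim[OF X(1,3,2)] by (simp add: dim_forms n_def)
  moreover have "n > 0" by (simp add: n_def)
  ultimately have "finite X" by (metis card.infinite less_numeral_extra(3))
  then obtain fs where fs: "distinct fs" "set fs = X"
    using finite_distinct_list by blast
  have len: "length fs = n" using fs cardX distinct_card by metis
  have lend: "length ders = (M + N) choose N"
    using ders M by (metis diff_Suc_1 distinct_card card_exponents)
  have n: "n = s + length ders" using C M lend by (simp add: n_def)
  define A where "A = mat n n (\<lambda>(i, k). if i < s then mpoly_const (mpoly_eval (p i) (fs ! k))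
              else adapted_partial N b i0 (ders ! (i - s)) (fs ! k))"
  define w where "w = (\<lambda>i. if i < s then 0 else M - poly_mapping.lookup (ders ! (i - s)) i0)"
  have "\<exists>U\<in>carrier_mat n n. \<exists>Q\<in>carrier_mat n n. interp_matrix N d s p mons ders = U * A * Q"
    unfolding A_def n_def
    by (rule interp_matrix_factorization[where M = M])
      (use C M mons ders b fs len X(3) in \<open>auto simp: n_def\<close>)
  then obtain U Q where UQ: "U \<in> carrier_mat n n" "Q \<in> carrier_mat n n"
      "interp_matrix N d s p mons ders = U * A * Q" by blast
  have A: "A \<in> carrier_mat n n" by (simp add: A_def)
  have "vanish_ge N b ((\<Sum>l<n. \<omega> (fs ! l)) - (\<Sum>i<n. w i)) (det A)"
  proof (rule vanish_ge_det[OF A])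
    fix i l assume il: "i < n" "l < n"
    define f where "f = fs ! l"
    have f: "f \<in> X" using il len fs(2) nth_mem by (auto simp: f_def)
    have in_linsys: "f \<in> linsys N d (\<omega> f) B Z" if "\<omega> f \<noteq> 0"
      using X_W[OF f] that by (simp add: W_def)
    show "vanish_ge N b (\<omega> (fs ! l) - w i) (A $$ (i, l))"
    proof (cases "i < s")
      case True
      have "mpoly_eval (p i) f = 0" if "\<omega> f \<noteq> 0"
        using in_linsys[OF that] p[OF True] True
        by (auto simp: linsys_def vanishes_at_def Z_def)
      then show ?thesis
        using True il by (cases "\<omega> f = 0") (auto simp: A_def f_def mpoly_const_def)
    next
      case False
      have "vanish_ge N b (\<omega> f) f"
        using in_linsys b(1) by (cases "\<omega> f = 0") (auto simp: linsys_def vanishes_to_order_iff)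
      moreover have "ders ! (i - s) \<in> exponents N M"
        using False il n ders(2) M nth_mem[of "i - s" ders] by simp
      moreover have "f \<in> forms N d" using f X(1) by blast
      ultimately show ?thesis
        using vanish_ge_adapted_partial[of "ders ! (i - s)" N M f d b "\<omega> f" i0] False il
        by (simp add: A_def w_def f_def)
    qed
  qed
  moreover have "det (interp_matrix N d s p mons ders) = det U * det A * det Q"
    unfolding UQ(3) using UQ(1,2) A by (simp add: det_mult[of _ n])
  ultimately have *: "vanish_ge N b ((\<Sum>l<n. \<omega> (fs ! l)) - (\<Sum>i<n. w i))
      (det (interp_matrix N d s p mons ders))"
    using vanish_ge_mult[of N b 0 "det U * det Q"] by (simp add: mult_ac)
  have sum_\<omega>: "(\<Sum>l<n. \<omega> (fs ! l)) = (\<Sum>j=1..d. mpoly.dim (linsys N d j B Z))"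
    using X_sum sum_set_eq_sum_nth[OF fs(1), of \<omega>] by (simp add: fs(2) len W_def)
  have sum_w: "int (\<Sum>i<n. w i) = (\<Sum>j=1..m. int n - int ((j + N - 1) choose N) - int s)"
  proof -
    have "(\<Sum>i<n. w i) = (\<Sum>i<length ders. M - poly_mapping.lookup (ders ! i) i0)"
      unfolding n sum_lessThan_add by (simp add: w_def)
    also have "\<dots> = (\<Sum>e\<in>exponents N M. M - poly_mapping.lookup e i0)"
      using sum_set_eq_sum_nth[OF ders(1), of "\<lambda>e. M - poly_mapping.lookup e i0"] ders(2) M by simp
    finally show ?thesis
      unfolding sum_adapted_weights[OF b(2)] M n lend
      by (simp only: sum_adapted_weights[OF b(2)]) (simp add: algebra_simps)
  qed
  have "h_total N d m s Z B = (\<Sum>j=1..d. int (mpoly.dim (linsys N d j B Z))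
      - (if j \<le> m then int n - int ((j + N - 1) choose N) - int s else 0))"
    unfolding h_total_def by (rule sum.cong) (auto simp: h_at_def n_def)
  also have "\<dots> = int (\<Sum>l<n. \<omega> (fs ! l)) - int (\<Sum>i<n. w i)"
  proof -
    have "{1..d} \<inter> {j. j \<le> m} = {1..m}" using \<open>d \<ge> m\<close> by auto
    then show ?thesis
      unfolding sum_\<omega> sum_w by (simp add: sum_subtractf sum.If_cases)
  qed
  finally have "nat (h_total N d m s Z B) = (\<Sum>l<n. \<omega> (fs ! l)) - (\<Sum>i<n. w i)" by (simp only: nat_minus_as_int)
  then show ?thesis using * by (simp add: Z_def)
qed

section \<open>Finiteness of the vanishing order\<close>

text \<open>
  The order of vanishing only tests derivatives with respect to the variables \<open>0, \<dots>, N\<close>. A nonzero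
  polynomial in further variables may pass all of these tests for every order.
\<close>

definition vars_le :: "nat \<Rightarrow> 'k::zero mpoly \<Rightarrow> bool" where
  "vars_le N f \<longleftrightarrow> (\<forall>t\<in>Poly_Mapping.keys f. Poly_Mapping.keys t \<subseteq> {..N})"

lemma vars_le_sum:
  fixes g :: "_ \<Rightarrow> 'k::comm_monoid_add mpoly"
  shows "(\<And>x. x \<in> X \<Longrightarrow> vars_le N (g x)) \<Longrightarrow> vars_le N (\<Sum>x\<in>X. g x)"
proof (induction X rule: infinite_finite_induct)
  case (insert x X)
  then show ?case
    using keys_add[of "g x" "sum g X"] by (fastforce simp: vars_le_def)
qed (simp_all add: vars_le_def)

lemma vars_le_mult:
  fixes f g :: "'k::comm_ring_1 mpoly"
  assumes "vars_le N f" "vars_le N g"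
  shows "vars_le N (f * g)"
  unfolding vars_le_def
proof
  fix t assume "t \<in> Poly_Mapping.keys (f * g)"
  then obtain u v where "t = u + v" "u \<in> Poly_Mapping.keys f" "v \<in> Poly_Mapping.keys g"
    using keys_mult[of f g] by blast
  then show "Poly_Mapping.keys t \<subseteq> {..N}"
    using assms keys_add[of u v] by (fastforce simp: vars_le_def)
qed

lemma vars_le_prod:
  fixes g :: "_ \<Rightarrow> 'k::comm_ring_1 mpoly"
  shows "(\<And>x. x \<in> X \<Longrightarrow> vars_le N (g x)) \<Longrightarrow> vars_le N (\<Prod>x\<in>X. g x)"
proof (induction X rule: infinite_finite_induct)
  case (insert x X)
  then show ?case by (simp add: vars_le_mult)
qed (simp_all add: vars_le_def)

lemma vars_le_det:
  fixes A :: "'k::comm_ring_1 mpoly mat"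
  assumes A: "A \<in> carrier_mat n n"
    and entry: "\<And>i l. i < n \<Longrightarrow> l < n \<Longrightarrow> vars_le N (A $$ (i, l))"
  shows "vars_le N (det A)"
  unfolding det_def'[OF A]
proof (intro vars_le_sum vars_le_mult vars_le_prod)
  fix \<pi> i assume "\<pi> \<in> {\<pi>. \<pi> permutes {0..<n}}" "i \<in> {0..<n}"
  then show "vars_le N (A $$ (i, \<pi> i))"
    using entry permutes_in_image[of \<pi> "{0..<n}" i] by auto
next
  fix \<pi> :: "nat \<Rightarrow> nat"
  show "vars_le N (of_int (sign \<pi>) :: 'k mpoly)"
    by (cases \<pi> rule: sign_cases) (simp_all add: vars_le_def)
qed

lemma mpoly_partial_forms:
  assumes "e \<in> exponents N r" "f \<in> forms N d"
  shows "mpoly_partial N e f \<in> forms N (d - r)"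
  using assms
proof (induction r arbitrary: e f d)
  case 0
  then show ?case by (simp add: exponents_0 mpoly_partial_eq_iter_deriv iter_deriv_0)
next
  case (Suc r)
  from Suc.prems(1) obtain i e' where i: "i \<le> N" "e' \<in> exponents N r"
    and e: "e = e' + Poly_Mapping.single i 1"
    by (rule exponents_SucE)
  from Suc.IH[OF i(2) mpoly_pderiv_forms[OF Suc.prems(2) i(1)]] show ?case
    unfolding e mpoly_partial_add_single[OF i(1)] by simp
qed

lemma forms_imp_vars_le: "f \<in> forms N d \<Longrightarrow> vars_le N f"
  by (auto simp: forms_def vars_le_def exponents_def)

lemma vars_le_interp_det:
  assumes C: "(d + N) choose N = ((m + N - 1) choose N) + s" and "m \<ge> 1"
    and mons: "distinct mons" "set mons = exponents N d"
    and ders: "distinct ders" "set ders = exponents N (m - 1)"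
  shows "vars_le N (det (interp_matrix N d s p mons ders))"
proof (rule vars_le_det)
  let ?n = "(d + N) choose N"
  show "interp_matrix N d s p mons ders \<in> carrier_mat ?n ?n"
    by (simp add: interp_matrix_def)
  have lenm: "length mons = ?n" using mons by (metis distinct_card card_exponents)
  have "length ders = (m - 1 + N) choose N" using ders by (metis distinct_card card_exponents)
  then have lend: "?n = length ders + s" using C \<open>m \<ge> 1\<close> by simp
  fix i l assume il: "i < ?n" "l < ?n"
  have "mons ! l \<in> exponents N d" using il lenm mons(2) nth_mem by metis
  then have w: "Poly_Mapping.single (mons ! l) 1 \<in> forms N d" by (simp add: forms_def)
  show "vars_le N (interp_matrix N d s p mons ders $$ (i, l))"
  proof (cases "i < s")
    case True
    then show ?thesis
      using il by (simp add: interp_matrix_def Let_def mpoly_const_def vars_le_def)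
  next
    case False
    then have "ders ! (i - s) \<in> exponents N (m - 1)"
      using il lend ders(2) nth_mem[of "i - s" ders] by simp
    from forms_imp_vars_le[OF mpoly_partial_forms[OF this w]] show ?thesis
      using il False by (simp add: interp_matrix_def Let_def)
  qed
qed

text \<open>
  Induction on the degree: a nonzero constant does not vanish, and a polynomial of positive degree has
  a nonzero derivative, because the exponent that appears as a factor is nonzero in characteristic
  zero.
\<close>

lemma finite_vanishing_order:
  fixes f :: "'k::field_char_0 mpoly"
  assumes "f \<noteq> 0" and vars: "\<And>t. t \<in> Poly_Mapping.keys f \<Longrightarrow> Poly_Mapping.keys t \<subseteq> {..N}"
  shows "\<exists>k. \<not> vanish_ge N b k f"
proof -
  define deg where "deg = (\<lambda>t::nat \<Rightarrow>\<^sub>0 nat. \<Sum>i\<le>N. poly_mapping.lookup t i)"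
  have "\<exists>k. \<not> vanish_ge N b k f"
    if "f \<noteq> 0" "\<And>t. t \<in> Poly_Mapping.keys f \<Longrightarrow> Poly_Mapping.keys t \<subseteq> {..N}"
      "\<And>t. t \<in> Poly_Mapping.keys f \<Longrightarrow> deg t \<le> n" for n and f :: "'k mpoly"
    using that
  proof (induction n arbitrary: f)
    case (0 f)
    have "t = 0" if "t \<in> Poly_Mapping.keys f" for t
    proof -
      have "t \<in> exponents N 0"
        using 0(2,3)[OF that] by (auto simp: exponents_def deg_def)
      then show ?thesis by (simp add: exponents_0)
    qed
    then have keys: "Poly_Mapping.keys f = {0}"
      using \<open>f \<noteq> 0\<close> by (metis keys_eq_empty subset_singletonD subsetI singleton_iff)
    then have "mpoly_eval b f \<noteq> 0"
      by (simp add: mpoly_eval_def) (metis in_keys_iff insertI1)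
    then show ?case by (intro exI[of _ 1]) simp
  next
    case (Suc n f)
    show ?case
    proof (cases "\<exists>i\<le>N. mpoly_pderiv i f \<noteq> 0")
      case True
      then obtain i where i: "i \<le> N" "mpoly_pderiv i f \<noteq> 0" by blast
      have "\<exists>k. \<not> vanish_ge N b k (mpoly_pderiv i f)"
      proof (rule Suc.IH[OF i(2)])
        fix t assume "t \<in> Poly_Mapping.keys (mpoly_pderiv i f)"
        then have t: "t + Poly_Mapping.single i 1 \<in> Poly_Mapping.keys f"
          by (auto simp: in_keys_iff lookup_mpoly_pderiv)
        show "deg t \<le> n"
          using Suc.prems(3)[OF t] sum_lookup_add_single[OF i(1), of t 1] by (simp add: deg_def)
        have "Poly_Mapping.keys t \<subseteq> Poly_Mapping.keys (t + Poly_Mapping.single i 1)"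
          by (auto simp: in_keys_iff lookup_add)
        then show "Poly_Mapping.keys t \<subseteq> {..N}"
          using Suc.prems(2)[OF t] by blast
      qed
      then show ?thesis using i(1) by (metis vanish_ge.simps(2))
    next
      case False
      have "deg t \<le> n" if t: "t \<in> Poly_Mapping.keys f" for t
      proof -
        have "deg t = 0"
        proof (rule ccontr)
          assume "deg t \<noteq> 0"
          then obtain q where "deg t = Suc q" by (metis not0_implies_Suc)
          then have "t \<in> exponents N (Suc q)"
            using Suc.prems(2)[OF t] by (simp add: exponents_def deg_def)
          then obtain i t' where i: "i \<le> N" "t = t' + Poly_Mapping.single i 1"
            by (elim exponents_SucE)
          then have "mpoly_pderiv i f = 0" using False by blast
          then have "of_nat (poly_mapping.lookup t' i + 1) * poly_mapping.lookup f t = 0"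
            using lookup_mpoly_pderiv[of i f t'] i(2) by simp
          then show False
            using t by (metis Suc_eq_plus1 in_keys_iff mult_eq_0_iff of_nat_neq_0)
        qed
        then show ?thesis by simp
      qed
      then show ?thesis using Suc.IH Suc.prems by blast
    qed
  qed
  from this[of f "Max (insert 0 (deg ` Poly_Mapping.keys f))"] show ?thesis
    using assms by auto
qed

text \<open>
  For \<open>f \<noteq> 0\<close> the orders \<open>j\<close> with \<open>vanishes_to_order N j f P\<close> are bounded, so the greatest one exists
  and is at least \<open>k\<close>.
\<close>

lemma le_vanishing_order:
  fixes f :: "'k::field_char_0 mpoly"
  assumes "vanishes_to_order N k f P" "vars_le N f" "P \<noteq> {}"
  shows "enat k \<le> vanishing_order N f P"
proof (cases "f = 0")
  case False
  obtain b where b: "b \<in> P" using assms(3) by blast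
  obtain K where K: "\<not> vanish_ge N b K f"
    using finite_vanishing_order[OF False] assms(2) unfolding vars_le_def by blast
  have "j \<le> K" if "vanishes_to_order N j f P" for j
    using that b K vanish_ge_mono[of K j N b f] by (force simp: vanishes_to_order_iff)
  then have "k \<le> (GREATEST k. vanishes_to_order N k f P)"
    using assms(1) by (intro Greatest_le_nat[where b = K])
  then show ?thesis using False by (simp add: vanishing_order_def)
qed (simp add: vanishing_order_def)

lemma proj_space_memberD:
  assumes "B \<in> proj_space N"
  shows "B \<noteq> {}" "\<And>b. b \<in> B \<Longrightarrow> \<exists>i\<le>N. b $ i \<noteq> 0"
proof -
  obtain v where v: "v \<in> carrier_vec (Suc N) - {0\<^sub>v (Suc N)}" "B = proj_rel N `` {v}"
    using assms by (auto simp: proj_space_def quotient_def)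
  have "(v, v) \<in> proj_rel N"
    using v(1) by (auto simp: proj_rel_def intro!: exI[of _ 1])
  then show "B \<noteq> {}" using v(2) by blast
  fix b assume "b \<in> B"
  then have "b \<in> carrier_vec (Suc N)" "b \<noteq> 0\<^sub>v (Suc N)"
    using v(2) by (auto simp: proj_rel_def)
  then show "\<exists>i\<le>N. b $ i \<noteq> 0"
    by (metis carrier_vecD eq_vecI index_zero_vec less_Suc_eq_le)
qed

theorem theorem2p3:
  fixes N d m s :: nat
    and P :: "nat \<Rightarrow> 'k::field_char_0 vec set"
    and B :: "'k vec set"
    and p :: "nat \<Rightarrow> 'k vec"
    and mons ders :: "(nat \<Rightarrow>\<^sub>0 nat) list"
  assumes "N \<ge> 1" and "d \<ge> 1" and "m \<ge> 1" and "d \<ge> m"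
    and "\<And>i. i < s \<Longrightarrow> P i \<in> proj_space N"
    and "inj_on P {..<s}"
    and "(d + N) choose N = ((m + N - 1) choose N) + s"
    and "B \<in> proj_space N"
    and "\<And>i. i < s \<Longrightarrow> p i \<in> P i"
    and "distinct mons" and "set mons = exponents N d"
    and "distinct ders" and "set ders = exponents N (m - 1)"
  defines "Z \<equiv> P ` {..<s}"
    and "F \<equiv> det (interp_matrix N d s p mons ders)"
  shows "ereal (of_int (h_total N d m s Z B)) \<le> ereal_of_enat (vanishing_order N F B)"
proof -
  let ?h = "h_total N d m s Z B"
  have "vanish_ge N b (nat ?h) F" if b: "b \<in> B" for b
  proof -
    obtain i0 where "i0 \<le> N" "b $ i0 \<noteq> 0"
      using proj_space_memberD(2)[OF \<open>B \<in> proj_space N\<close> b] by blast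
    then show ?thesis
      unfolding F_def Z_def using assms b by (intro vanish_ge_interp_det) auto
  qed
  then have "vanishes_to_order N (nat ?h) F B" by (simp add: vanishes_to_order_iff)
  moreover have "vars_le N F"
    unfolding F_def by (rule vars_le_interp_det[where m = m]) (use assms in auto)
  ultimately have "enat (nat ?h) \<le> vanishing_order N F B"
    using proj_space_memberD(1)[OF \<open>B \<in> proj_space N\<close>] by (rule le_vanishing_order)
  then have "ereal_of_enat (enat (nat ?h)) \<le> ereal_of_enat (vanishing_order N F B)"
    by (simp only: ereal_of_enat_le_iff)
  moreover have "ereal (of_int ?h) \<le> ereal_of_enat (enat (nat ?h))" by simp
  ultimately show ?thesis by (rule order_trans[rotated])
qed

end
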